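(* Let $\hat\iota\colon \mathbf{SL}_3(\mathbb{Z}[t])\to \mathbf{SL}_3(\mathbb{Z}/3\mathbb{Z})$ be the group homomorphism induced by the ring homomorphism $\iota\colon\mathbb{Z}[t]\to\mathbb{Z}/3\mathbb{Z}$ that sends $t\mapsto 0$ and reduces integers modulo $3$, and let $\Gamma=\ker(\hat\iota)$. Then the group cohomology $H^2(\Gamma;\mathbb{Q})$ (trivial coefficients) is an infinite dimensional $\mathbb{Q}$-vector space.
   Context: $\Gamma$ is a finite index subgroup of $\mathbf{SL}_3(\mathbb{Z}[t])$, since $\mathbf{SL}_3(\mathbb{Z}/3\mathbb{Z})$ is finite. *)

theory Defs
  imports Jordan_Normal_Form.VS_Connect "HOL-Algebra.AbelCoset" "HOL-Library.Numeral_Type"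
begin

definition quot_module :: "('a, 'b, 'c) module_scheme \<Rightarrow> 'b set \<Rightarrow> ('a, 'b set) module" where
  "quot_module M N =
    \<lparr>carrier = a_rcosets\<^bsub>M\<^esub> N,
     mult = (\<lambda>X Y. N), one = N, \<comment> \<open>unused fields of the record\<close>
     zero = N,
     add = (\<lambda>X Y. X <+>\<^bsub>M\<^esub> Y),
     smult = (\<lambda>c X. \<Union>x\<in>X. N +>\<^bsub>M\<^esub> (c \<odot>\<^bsub>M\<^esub> x))\<rparr>"

lemma submodule_abelian_subgroup:
  assumes "submodule R N M"
  shows "abelian_subgroup N M"
proof -
  interpret N: submodule R N M by fact
  interpret Module.module R M by (rule N.module)
  show ?thesis
  proof (rule abelian_subgroupI3)
    show "additive_subgroup N M"
    proof (unfold additive_subgroup_def, rule M.add.subgroupI)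
      fix x assume x: "x \<in> N"
      have "\<ominus>\<^bsub>R\<^esub> \<one>\<^bsub>R\<^esub> \<odot>\<^bsub>M\<^esub> x \<in> N"
        by (rule N.smult_closed) (simp_all add: x)
      moreover have "\<ominus>\<^bsub>R\<^esub> \<one>\<^bsub>R\<^esub> \<odot>\<^bsub>M\<^esub> x = \<ominus>\<^bsub>M\<^esub> x"
        using x N.subset by (intro smult_minus_1) auto
      ultimately show "\<ominus>\<^bsub>M\<^esub> x \<in> N" by simp
    next
      show "N \<noteq> {}" using N.zero_closed by blast
    qed (use N.subset in auto)
  qed (rule M.abelian_group_axioms)
qed

lemma quot_module_vectorspace:
  assumes V: "vectorspace K V" and N: "submodule K N V"
  shows "vectorspace K (quot_module V N)"
proof -
  interpret V: vectorspace K V by fact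
  interpret N: submodule K N V by fact
  interpret S: abelian_subgroup N V by (rule submodule_abelian_subgroup[OF N])
  let ?c = "\<lambda>x. N +>\<^bsub>V\<^esub> x"
  have add: "?c x <+>\<^bsub>V\<^esub> ?c y = ?c (x \<oplus>\<^bsub>V\<^esub> y)" if "x \<in> carrier V" "y \<in> carrier V" for x y
    using that by (rule S.a_rcos_sum)
  have smult: "(\<Union>y\<in>?c x. ?c (c \<odot>\<^bsub>V\<^esub> y)) = ?c (c \<odot>\<^bsub>V\<^esub> x)"
    if x: "x \<in> carrier V" and c: "c \<in> carrier K" for x c
  proof -
    have "?c (c \<odot>\<^bsub>V\<^esub> y) = ?c (c \<odot>\<^bsub>V\<^esub> x)" if y: "y \<in> ?c x" for y
    proof -
      obtain h where h: "h \<in> N" "y = h \<oplus>\<^bsub>V\<^esub> x"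
        using y by (auto simp: a_r_coset_def')
      have "h \<in> carrier V" using h N.subset by auto
      then have "c \<odot>\<^bsub>V\<^esub> y = c \<odot>\<^bsub>V\<^esub> h \<oplus>\<^bsub>V\<^esub> c \<odot>\<^bsub>V\<^esub> x"
        using h x c by (simp add: V.smult_r_distr)
      then have "c \<odot>\<^bsub>V\<^esub> y \<in> ?c (c \<odot>\<^bsub>V\<^esub> x)"
        using h c by (auto simp: a_r_coset_def')
      then show ?thesis
        using S.a_repr_independence' x c by auto
    qed
    moreover have "?c x \<noteq> {}" using S.a_rcos_self x by auto
    ultimately show ?thesis by (intro SUP_eq_const)
  qed
  have car: "carrier (quot_module V N) = ?c ` carrier V"
    by (auto simp: quot_module_def A_RCOSETS_def')
  have zero: "\<zero>\<^bsub>quot_module V N\<^esub> = ?c \<zero>\<^bsub>V\<^esub>"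
    using N.subset by (simp add: quot_module_def)
  have addq: "?c x \<oplus>\<^bsub>quot_module V N\<^esub> ?c y = ?c (x \<oplus>\<^bsub>V\<^esub> y)"
    if "x \<in> carrier V" "y \<in> carrier V" for x y
    using add that by (simp add: quot_module_def)
  have smultq: "c \<odot>\<^bsub>quot_module V N\<^esub> ?c x = ?c (c \<odot>\<^bsub>V\<^esub> x)"
    if "x \<in> carrier V" "c \<in> carrier K" for x c
    using smult that by (simp add: quot_module_def)
  show ?thesis
  proof (rule vs_criteria)
    show "field K" ..
    show "\<forall>v\<in>carrier (quot_module V N). \<exists>w\<in>carrier (quot_module V N).
        v \<oplus>\<^bsub>quot_module V N\<^esub> w = \<zero>\<^bsub>quot_module V N\<^esub>"
    proof
      fix v assume "v \<in> carrier (quot_module V N)"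
      then obtain x where x: "x \<in> carrier V" "v = ?c x" by (auto simp: car)
      then show "\<exists>w\<in>carrier (quot_module V N).
          v \<oplus>\<^bsub>quot_module V N\<^esub> w = \<zero>\<^bsub>quot_module V N\<^esub>"
        by (intro bexI[of _ "?c (\<ominus>\<^bsub>V\<^esub> x)"]) (auto simp: addq zero car V.r_neg)
    qed
  qed (auto simp: car zero addq smultq V.a_ac V.smult_assoc1 V.smult_l_distr V.smult_r_distr)
qed

definition tuples :: "('g, 'm) monoid_scheme \<Rightarrow> nat \<Rightarrow> 'g list set" where
  "tuples G n = {xs. length xs = n \<and> set xs \<subseteq> carrier G}"

definition cochains :: "('g, 'm) monoid_scheme \<Rightarrow> nat \<Rightarrow> ('k::field, 'g list \<Rightarrow> 'k) module" where
  "cochains G n = class_ring.func_space (tuples G n)"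

text \<open>The faces of \<open>[g\<^sub>1, \<dots>, g\<^sub>n]\<close> in the bar construction: \<open>[g\<^sub>2, \<dots>, g\<^sub>n]\<close> for \<open>i = 0\<close>,
  \<open>[g\<^sub>1, \<dots>, g\<^sub>i g\<^sub>i\<^sub>+\<^sub>1, \<dots>, g\<^sub>n]\<close> for \<open>0 < i < n\<close>, and \<open>[g\<^sub>1, \<dots>, g\<^sub>n\<^sub>-\<^sub>1]\<close> for \<open>i = n\<close>.\<close>

definition bar_face :: "('g, 'm) monoid_scheme \<Rightarrow> nat \<Rightarrow> 'g list \<Rightarrow> 'g list" where
  "bar_face G i xs =
    (if i = 0 then tl xs
     else if i = length xs then butlast xs
     else take (i - 1) xs @ [xs ! (i - 1) \<otimes>\<^bsub>G\<^esub> xs ! i] @ drop (i + 1) xs)"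

text \<open>The inhomogeneous differential from degree \<open>n\<close> to degree \<open>n + 1\<close>.  As the coefficients
  are trivial, \<open>g\<^sub>1\<close> does not act in the term with \<open>i = 0\<close>.\<close>

definition coboundary ::
  "('g, 'm) monoid_scheme \<Rightarrow> nat \<Rightarrow> ('g list \<Rightarrow> 'k::field) \<Rightarrow> 'g list \<Rightarrow> 'k" where
  "coboundary G n f =
    restrict (\<lambda>xs. \<Sum>i\<le>Suc n. (- 1) ^ i * f (bar_face G i xs)) (tuples G (Suc n))"

definition cocycles :: "('g, 'm) monoid_scheme \<Rightarrow> nat \<Rightarrow> ('g list \<Rightarrow> 'k::field) set" where
  "cocycles G n = {f \<in> carrier (cochains G n). coboundary G n f = \<zero>\<^bsub>cochains G (Suc n)\<^esub>}"

definition coboundaries :: "('g, 'm) monoid_scheme \<Rightarrow> nat \<Rightarrow> ('g list \<Rightarrow> 'k::field) set" where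
  "coboundaries G n =
    (case n of 0 \<Rightarrow> {\<zero>\<^bsub>cochains G 0\<^esub>} | Suc m \<Rightarrow> coboundary G m ` carrier (cochains G m))"

definition cohomology ::
  "('g, 'm) monoid_scheme \<Rightarrow> nat \<Rightarrow> ('k::field, ('g list \<Rightarrow> 'k) set) module" where
  "cohomology G n = quot_module ((cochains G n)\<lparr>carrier := cocycles G n\<rparr>) (coboundaries G n)"

lemma cochains_simps:
  "carrier (cochains G n :: ('k::field, _) module) = tuples G n \<rightarrow>\<^sub>E UNIV"
  "zero (cochains G n :: ('k::field, _) module) = restrict (\<lambda>_. 0) (tuples G n)"
  "add (cochains G n :: ('k::field, _) module) = (\<lambda>f g. restrict (\<lambda>x. f x + g x) (tuples G n))"
  "smult (cochains G n :: ('k::field, _) module) = (\<lambda>c f. restrict (\<lambda>x. c * f x) (tuples G n))"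
  by (simp_all add: cochains_def class_ring.func_space_def)

lemma field_class_ring: "field (class_ring :: 'k::field ring)"
  by (rule class_field.field_axioms)

lemma cochains_module: "module class_ring (cochains G n :: ('k::field, _) module)"
  unfolding cochains_def by (rule class_cring.func_space_is_module)

lemma cochains_vectorspace: "vectorspace class_ring (cochains G n :: ('k::field, _) module)"
  unfolding vectorspace_def using cochains_module field_class_ring by blast

lemma length_bar_face: "i \<le> length xs \<Longrightarrow> length (bar_face G i xs) = length xs - 1"
  by (auto simp: bar_face_def)

lemma nth_bar_face:
  assumes "i \<le> length xs" "k < length xs - 1"
  shows "bar_face G i xs ! k =
    (if Suc k < i then xs ! k else if Suc k = i then xs ! k \<otimes>\<^bsub>G\<^esub> xs ! Suc k else xs ! Suc k)"
  using assms by (auto simp: bar_face_def nth_tl nth_butlast nth_append nth_Cons' min_def)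

lemma bar_face_in_tuples:
  assumes "monoid G" "xs \<in> tuples G (Suc n)" "i \<le> Suc n"
  shows "bar_face G i xs \<in> tuples G n"
proof -
  interpret monoid G by fact
  have l: "length xs = Suc n" and c: "\<And>k. k < Suc n \<Longrightarrow> xs ! k \<in> carrier G"
    using assms by (auto simp: tuples_def)
  have "bar_face G i xs ! k \<in> carrier G" if "k < n" for k
    using that assms(3) l c[of k] c[of "Suc k"] by (subst nth_bar_face) auto
  then show ?thesis
    using l assms(3) by (auto simp: tuples_def length_bar_face in_set_conv_nth)
qed

lemma bar_face_bar_face:
  assumes "monoid G" "xs \<in> tuples G (Suc (Suc n))" "i \<le> j" "j \<le> Suc n"
  shows "bar_face G j (bar_face G i xs) = bar_face G i (bar_face G (Suc j) xs)"
proof -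
  interpret monoid G by fact
  have l: "length xs = Suc (Suc n)" and c: "\<And>k. k < Suc (Suc n) \<Longrightarrow> xs ! k \<in> carrier G"
    using assms by (auto simp: tuples_def)
  show ?thesis
  proof (rule nth_equalityI)
    fix k assume "k < length (bar_face G j (bar_face G i xs))"
    then have k: "k < n" using l assms by (simp add: length_bar_face)
    show "bar_face G j (bar_face G i xs) ! k = bar_face G i (bar_face G (Suc j) xs) ! k"
      using k l assms(3,4) c[of k] c[of "Suc k"] c[of "Suc (Suc k)"]
      by (auto simp: nth_bar_face length_bar_face m_assoc)
  qed (use l assms in \<open>simp add: length_bar_face\<close>)
qed

lemma coboundary_coboundary:
  assumes "monoid G"
  shows "coboundary G (Suc n) (coboundary G n (f :: _ \<Rightarrow> 'k::field)) = \<zero>\<^bsub>cochains G (Suc (Suc n))\<^esub>"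
proof -
  have "(\<Sum>j\<le>Suc (Suc n). (- 1) ^ j * coboundary G n f (bar_face G j xs)) = 0"
    if xs: "xs \<in> tuples G (Suc (Suc n))" for xs
  proof -
    define t where "t j i = (- 1) ^ (i + j) * f (bar_face G i (bar_face G j xs))" for i j :: nat
    let ?A = "{..Suc (Suc n)} \<times> {..Suc n}"
    let ?L = "{p \<in> ?A. snd p < fst p}" and ?U = "{p \<in> ?A. fst p \<le> snd p}"
    have "(\<Sum>j\<le>Suc (Suc n). (- 1) ^ j * coboundary G n f (bar_face G j xs))
        = (\<Sum>j\<le>Suc (Suc n). \<Sum>i\<le>Suc n. t j i)"
    proof (intro sum.cong refl)
      fix j assume "j \<in> {..Suc (Suc n)}"
      then have "bar_face G j xs \<in> tuples G (Suc n)"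
        using bar_face_in_tuples[OF assms xs] by simp
      then have "coboundary G n f (bar_face G j xs)
          = (\<Sum>i\<le>Suc n. (- 1) ^ i * f (bar_face G i (bar_face G j xs)))"
        unfolding coboundary_def by (rule restrict_apply')
      then show "(- 1) ^ j * coboundary G n f (bar_face G j xs) = (\<Sum>i\<le>Suc n. t j i)"
        by (simp only: t_def sum_distrib_left power_add mult_ac)
    qed
    also have "\<dots> = (\<Sum>p\<in>?A. t (fst p) (snd p))"
      by (simp only: sum.cartesian_product case_prod_unfold)
    also have "\<dots> = (\<Sum>p\<in>?L \<union> ?U. t (fst p) (snd p))"
      by (rule sum.cong) auto
    also have "\<dots> = (\<Sum>p\<in>?L. t (fst p) (snd p)) + (\<Sum>p\<in>?U. t (fst p) (snd p))"
      by (rule sum.union_disjoint) auto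
    also have "(\<Sum>p\<in>?L. t (fst p) (snd p)) = (\<Sum>p\<in>?U. - t (fst p) (snd p))"
    proof (rule sum.reindex_bij_witness[of _ "\<lambda>(i, j). (Suc j, i)" "\<lambda>(j, i). (i, j - 1)"])
      fix p assume p: "p \<in> ?L"
      obtain j i where ji: "p = (Suc j, i)" "i \<le> j" "j \<le> Suc n"
        using p by (cases p; cases "fst p") auto
      show "- t (fst (case p of (j, i) \<Rightarrow> (i, j - 1))) (snd (case p of (j, i) \<Rightarrow> (i, j - 1)))
          = t (fst p) (snd p)"
        using ji bar_face_bar_face[OF assms xs ji(2,3)] by (simp add: t_def add.commute)
    qed auto
    finally show ?thesis by (simp add: sum_negf)
  qed
  then show ?thesis
    by (auto simp: coboundary_def[of G "Suc n"] cochains_simps restrict_def simp del: sum.atMost_Suc)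
qed

lemma coboundary_hom:
  assumes "monoid G"
  shows "mod_hom class_ring (cochains G n) (cochains G (Suc n))
    (coboundary G n :: _ \<Rightarrow> _ \<Rightarrow> 'k::field)"
proof (intro mod_hom.intro cochains_module mod_hom_axioms.intro)
  show "coboundary G n \<in> LinearCombinations.module_hom class_ring (cochains G n)
      (cochains G (Suc n) :: ('k, _) module)"
    by (auto simp: LinearCombinations.module_hom_def cochains_simps coboundary_def fun_eq_iff restrict_def
        bar_face_in_tuples[OF assms] ring_distribs sum.distrib sum_distrib_left mult_ac
        simp del: sum.atMost_Suc intro!: sum.cong)
qed

lemma cohomology_vectorspace:
  assumes "monoid G"
  shows "vectorspace class_ring (cohomology G n :: ('k::field, _) module)"
proof -
  let ?C = "cochains G n :: ('k, _) module"
  let ?Z = "?C\<lparr>carrier := cocycles G n\<rparr>"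
  interpret C: vectorspace class_ring ?C by (rule cochains_vectorspace)
  interpret d: mod_hom class_ring ?C "cochains G (Suc n)" "coboundary G n"
    by (rule coboundary_hom[OF assms])
  have "cocycles G n = d.ker" by (simp add: cocycles_def d.ker_def)
  then have Z: "submodule class_ring (cocycles G n) ?C"
    using d.ker_is_submodule by simp
  then have VZ: "vectorspace class_ring ?Z"
    by (intro C.subspace_is_vs subspace.intro cochains_vectorspace)
  have B: "submodule class_ring (coboundaries G n) ?C"
  proof (cases n)
    case 0
    show ?thesis
      by (rule submodule.intro) (use 0 cochains_module in \<open>auto simp: coboundaries_def cochains_simps restrict_def\<close>)
  next
    case (Suc m)
    interpret e: mod_hom class_ring "cochains G m" "cochains G (Suc m) :: ('k, _) module"
      "coboundary G m"
      by (rule coboundary_hom[OF assms])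
    show ?thesis using e.im_is_submodule Suc by (simp add: e.im_def coboundaries_def)
  qed
  have "coboundaries G n \<subseteq> (cocycles G n :: (_ \<Rightarrow> 'k) set)"
  proof
    fix b :: "'a list \<Rightarrow> 'k" assume b: "b \<in> coboundaries G n"
    have "coboundary G n b = \<zero>\<^bsub>cochains G (Suc n)\<^esub>"
      using b coboundary_coboundary[OF assms] d.f0_is_0
      by (cases n) (auto simp: coboundaries_def)
    then show "b \<in> cocycles G n"
      using b B by (auto simp: cocycles_def submodule_def)
  qed
  then have "submodule class_ring (coboundaries G n) ?Z"
    using B VZ by (auto simp: submodule_def vectorspace_def)
  then show ?thesis
    unfolding cohomology_def by (rule quot_module_vectorspace[OF VZ])
qed

definition SL :: "nat \<Rightarrow> 'a::comm_ring_1 mat monoid" where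
  "SL n = \<lparr>carrier = {A \<in> carrier_mat n n. det A = 1}, mult = (*), one = 1\<^sub>m n\<rparr>"

text \<open>The numeral type \<open>3\<close>, with its arithmetic modulo three, is the ring \<open>\<int>/3\<int>\<close>.\<close>

definition iota :: "int poly \<Rightarrow> 3" where
  "iota p = of_int (poly p 0)"

definition iota_hat :: "int poly mat \<Rightarrow> 3 mat" where
  "iota_hat = map_mat iota"

definition Gamma :: "int poly mat monoid" where
  "Gamma = (SL 3)\<lparr>carrier := kernel (SL 3) (SL 3) iota_hat\<rparr>"

lemma group_SL: "group (SL n :: 'a::comm_ring_1 mat monoid)"
proof (rule groupI)
  fix A :: "'a mat" assume "A \<in> carrier (SL n)"
  then have A: "A \<in> carrier_mat n n" "det A = 1" by (auto simp: SL_def)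
  note adj = adj_mat[OF A(1)]
  have "adj_mat A * A = 1\<^sub>m n" using adj(3) A by (auto intro!: eq_matI)
  moreover from this have "det (adj_mat A) = 1"
    using det_mult[OF adj(1) A(1)] A(2) by simp
  ultimately show "\<exists>B\<in>carrier (SL n). B \<otimes>\<^bsub>SL n\<^esub> A = \<one>\<^bsub>SL n\<^esub>"
    using adj(1) by (auto simp: SL_def)
qed (auto simp: SL_def det_mult assoc_mult_mat[of _ n n _ n _ n])

interpretation iota: comm_ring_hom iota
  by unfold_locales (auto simp: iota_def)

lemma iota_monom: "iota [:0, 1:] = 0" "iota [:c:] = of_int c"
  by (simp_all add: iota_def)

lemma iota_hat_hom: "group_hom (SL n) (SL n) iota_hat"
proof -
  have "iota_hat \<in> hom (SL n) (SL n)"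
    by (auto simp: hom_def SL_def iota_hat_def iota.hom_det iota.mat_hom_mult[of _ n n _ n])
  then show ?thesis
    by (simp add: group_hom_def group_hom_axioms_def group_SL)
qed

lemma group_Gamma: "group Gamma"
  unfolding Gamma_def
  using group_hom.subgroup_kernel[OF iota_hat_hom[of 3]]
  by (rule subgroup.subgroup_is_group[OF _ group_SL])

end

theory Submission
  imports Defs "HOL-Library.Product_Plus"
begin

text \<open>Evaluation at \<open>t = 3n\<close> maps \<open>\<Gamma>\<close> to the level three congruence subgroup \<open>\<Gamma>(3)\<close> of
  \<open>SL\<^sub>3(\<int>)\<close>, so a single class in \<open>H\<^sup>2(\<Gamma>(3); \<rat>)\<close> pulls back to a sequence of classes on \<open>\<Gamma>\<close>. The
  class used here counts intersections in the space of positive definite quadratic forms on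
  \<open>\<real>\<^sup>3\<close>. A pair \<open>(v, w)\<close> of an integral vector and an integral linear form with \<open>w(v) = 1\<close>, both
  congruent to the third basis vector modulo 3, determines the codimension two set of forms \<open>q\<close>
  for which \<open>v\<close> is orthogonal to the kernel of \<open>w\<close>, that is, \<open>q v\<close> is proportional to \<open>w\<close>. Since
  this condition is linear in \<open>q\<close>, a straight triangle with vertices in the orbit of a base form
  meets it as often as the triangle of the vectors \<open>q\<^sub>i v\<close> modulo \<open>w\<close> winds around the origin of
  the plane. Summing over all pairs gives an invariant cocycle. The base form is chosen off all
  these sets, but edges may meet them, whence the half-integral winding numbers.

  With \<open>e\<^sub>i\<^sub>j(x)\<close> the elementary matrices, the torus of the commuting matrices \<open>e\<^sub>1\<^sub>3(3)\<close> and
  \<open>e\<^sub>2\<^sub>3(3k)\<close> lies so deep in a cusp that only the translates of one such set contribute, and the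
  class takes a nonzero multiple of \<open>k\<close> on it. So the pullback along \<open>t = 3n\<close> takes the value
  \<open>(3n)\<^sup>m\<close>, up to a constant, on the torus of \<open>e\<^sub>1\<^sub>3(3)\<close> and \<open>e\<^sub>2\<^sub>3(3t\<^sup>m)\<close>, and the pullbacks are
  linearly independent by a Vandermonde argument.\<close>

section \<open>Integral vectors in dimension three\<close>

type_synonym vec3 = "int \<times> int \<times> int"

fun dot3 :: "vec3 \<Rightarrow> vec3 \<Rightarrow> int" where
  "dot3 (a, b, c) (x, y, z) = a * x + b * y + c * z"

fun cross3 :: "vec3 \<Rightarrow> vec3 \<Rightarrow> vec3" where
  "cross3 (a, b, c) (x, y, z) = (b * z - c * y, c * x - a * z, a * y - b * x)"

fun scale3 :: "int \<Rightarrow> vec3 \<Rightarrow> vec3" where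
  "scale3 k (x, y, z) = (k * x, k * y, k * z)"

definition triple :: "vec3 \<Rightarrow> vec3 \<Rightarrow> vec3 \<Rightarrow> int" where
  "triple w x y = dot3 (cross3 w x) y"

lemma triple_swap: "triple w y x = - triple w x y"
  by (cases w; cases x; cases y) (simp add: triple_def algebra_simps)

text \<open>\<open>triple w\<close> is a determinant form on the plane of vectors modulo
  \<open>w\<close>; this is the three-term Pluecker relation for four vectors in that plane.\<close>

lemma triple_plucker:
  "triple w x0 x1 * triple w x2 x3 - triple w x0 x2 * triple w x1 x3
    + triple w x0 x3 * triple w x1 x2 = 0"
  by (cases w; cases x0; cases x1; cases x2; cases x3) (simp add: triple_def algebra_simps)

text \<open>Cramer's rule for the linear relation among \<open>w\<close>, \<open>x0\<close>,
  \<open>x1\<close>, \<open>x2\<close>, paired with \<open>v\<close>.\<close>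

lemma triple_cramer:
  "triple w x1 x2 * dot3 x0 v + triple w x2 x0 * dot3 x1 v + triple w x0 x1 * dot3 x2 v
    = triple x0 x1 x2 * dot3 w v"
  by (cases w; cases x0; cases x1; cases x2; cases v) (simp add: triple_def algebra_simps)

text \<open>\<open>dot3 w v = 1\<close> makes \<open>w\<close> primitive, so a parallel vector is an
  integral multiple of it, and pairing with \<open>v\<close> reads off the factor.\<close>

lemma cross3_eq_0D:
  assumes "cross3 w x = (0, 0, 0)" "dot3 w v = 1"
  shows "x = scale3 (dot3 x v) w"
proof -
  obtain a b c where w: "w = (a, b, c)" by (cases w)
  obtain p q r where x: "x = (p, q, r)" by (cases x)
  obtain k l m where v: "v = (k, l, m)" by (cases v)
  have *: "b * r = c * q" "c * p = a * r" "a * q = b * p" and d: "a * k + b * l + c * m = 1"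
    using assms by (simp_all add: w x v)
  have "p = k * (a * p) + l * (b * p) + m * (c * p)" "q = k * (a * q) + l * (b * q) + m * (c * q)"
    "r = k * (a * r) + l * (b * r) + m * (c * r)"
    using arg_cong[OF d, of "\<lambda>z. z * p"] arg_cong[OF d, of "\<lambda>z. z * q"] arg_cong[OF d, of "\<lambda>z. z * r"]
    by (simp_all add: algebra_simps)
  then have "p = k * (a * p) + l * (a * q) + m * (a * r)" "q = k * (b * p) + l * (b * q) + m * (b * r)"
    "r = k * (c * p) + l * (c * q) + m * (c * r)"
    by (simp_all only: *)
  then have "p = (p * k + q * l + r * m) * a" "q = (p * k + q * l + r * m) * b"
    "r = (p * k + q * l + r * m) * c"
    by (simp_all add: algebra_simps)
  then show ?thesis by (simp add: w x v)
qed

lemma dot3_0 [simp]: "dot3 (0, 0, 0) y = 0"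
  by (cases y) simp

lemma dot3_0_right [simp]: "dot3 x (0, 0, 0) = 0"
  by (cases x) simp

lemma parallel_dot3_sgn:
  assumes "cross3 x y = (0, 0, 0)" "x \<noteq> (0, 0, 0)" "y \<noteq> (0, 0, 0)"
  obtains e where "e = 1 \<or> e = - 1" "\<And>z. sgn (dot3 y z) = e * sgn (dot3 x z)"
proof -
  obtain a b c where x: "x = (a, b, c)" by (cases x)
  obtain p q r where y: "y = (p, q, r)" by (cases y)
  have *: "b * r = c * q" "c * p = a * r" "a * q = b * p"
    using assms(1) by (simp_all add: x y)
  have "\<exists>s t. s \<noteq> 0 \<and> t \<noteq> 0 \<and> s * p = t * a \<and> s * q = t * b \<and> s * r = t * c"
  proof -
    consider "a \<noteq> 0" | "b \<noteq> 0" | "c \<noteq> 0" using assms(2) by (auto simp: x)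
    then show ?thesis
    proof cases
      case 1
      then have "p \<noteq> 0" using * assms(3) by (auto simp: y)
      with 1 * show ?thesis by (intro exI[of _ a] exI[of _ p]) (simp add: mult.commute)
    next
      case 2
      then have "q \<noteq> 0" using * assms(3) by (auto simp: y)
      with 2 * show ?thesis by (intro exI[of _ b] exI[of _ q]) (simp add: mult.commute)
    next
      case 3
      then have "r \<noteq> 0" using * assms(3) by (auto simp: y)
      with 3 * show ?thesis by (intro exI[of _ c] exI[of _ r]) (simp add: mult.commute)
    qed
  qed
  then obtain s t where st: "s \<noteq> 0" "t \<noteq> 0" "s * p = t * a" "s * q = t * b" "s * r = t * c"
    by blast
  have sgn: "sgn (dot3 y z) = sgn s * sgn t * sgn (dot3 x z)" for z
  proof -
    obtain k l m where z: "z = (k, l, m)" by (cases z)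
    have "s * dot3 y z = t * dot3 x z"
      using st(3-) unfolding x y z by (simp add: distrib_left mult.assoc[symmetric])
    then have "sgn s * sgn (dot3 y z) = sgn t * sgn (dot3 x z)"
      by (metis sgn_mult)
    moreover have "sgn s = 1 \<or> sgn s = - 1" using st(1) by (simp add: sgn_if)
    ultimately show ?thesis by auto
  qed
  show ?thesis
    by (rule that[of "sgn s * sgn t"]) (use st sgn in \<open>auto simp: sgn_if\<close>)
qed

lemma cross3_cross3: "cross3 (cross3 w x) (cross3 w y) = scale3 (triple w x y) w"
  by (cases w; cases x; cases y) (simp add: triple_def algebra_simps)

text \<open>Vectors that are parallel and nonzero modulo \<open>w\<close> have parallel cross
  products with \<open>w\<close>, by \<open>cross3_cross3\<close>. This handles the degenerate cases
  of \<open>winding_cocycle\<close>.\<close>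

lemma triple_eq_0_sgn:
  assumes "cross3 w x \<noteq> (0, 0, 0)" "cross3 w y \<noteq> (0, 0, 0)" "triple w x y = 0"
  obtains e where "e = 1 \<or> e = - 1" "\<And>z. sgn (triple w y z) = e * sgn (triple w x z)"
proof -
  have "cross3 (cross3 w x) (cross3 w y) = (0, 0, 0)"
    using assms(3) by (cases w) (simp add: cross3_cross3)
  from parallel_dot3_sgn[OF this assms(1,2)] that show thesis
    unfolding triple_def by blast
qed

section \<open>The winding number of a triangle\<close>

text \<open>For a triangle in the plane not having the origin as a vertex, with \<open>a\<close>, \<open>b\<close>, \<open>c\<close> the
  determinants of consecutive vertices, this is four times the winding number around the
  origin, where an origin on an edge counts one half.\<close>

definition winding :: "int \<Rightarrow> int \<Rightarrow> int \<Rightarrow> int" where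
  "winding a b c = sgn a + sgn b + sgn c + sgn a * sgn b * sgn c"

text \<open>If two signs are opposite, the sum equals the third sign and the product its negative,
  so they cancel.\<close>

lemma winding_neq_0D:
  assumes "winding a b c \<noteq> 0"
  shows "(a \<ge> 0 \<and> b \<ge> 0 \<and> c \<ge> 0 \<or> a \<le> 0 \<and> b \<le> 0 \<and> c \<le> 0) \<and> (a \<noteq> 0 \<or> b \<noteq> 0 \<or> c \<noteq> 0)"
  using assms by (auto simp: winding_def sgn_if split: if_splits)

text \<open>Let \<open>A\<close>, \<open>B\<close>, \<open>C\<close> be the signs of
  \<open>a * f\<close>, \<open>b * e\<close>, \<open>c * d\<close>. The left side is
  \<open>sgn d * sgn e * sgn f\<close> times \<open>1 - B * C + A * C - A * B\<close>, which
  vanishes unless \<open>A = - B = C\<close>. In that case the three summands of \<open>P\<close>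
  would share a sign.\<close>

lemma sgn_plucker:
  fixes a b c d e f :: int
  assumes P: "a * f - b * e + c * d = 0"
    and nz: "a \<noteq> 0" "b \<noteq> 0" "c \<noteq> 0" "d \<noteq> 0" "e \<noteq> 0" "f \<noteq> 0"
  shows "sgn d * sgn f * sgn e - sgn b * sgn f * sgn c + sgn a * sgn e * sgn c
    - sgn a * sgn d * sgn b = 0"
proof -
  have sgn: "sgn x = 1 \<or> sgn x = - 1" if "x \<noteq> 0" for x :: int
    using that by (simp add: sgn_if)
  have "\<not> (a * f > 0 \<and> b * e < 0 \<and> c * d > 0)" "\<not> (a * f < 0 \<and> b * e > 0 \<and> c * d < 0)"
    using P by linarith+
  then have "\<not> (sgn a * sgn f = 1 \<and> sgn b * sgn e = - 1 \<and> sgn c * sgn d = 1)"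
    "\<not> (sgn a * sgn f = - 1 \<and> sgn b * sgn e = 1 \<and> sgn c * sgn d = - 1)"
    by (simp_all add: sgn_mult[symmetric] sgn_1_pos sgn_1_neg)
  with nz[THEN sgn] show ?thesis
    by (elim disjE) simp_all
qed

text \<open>The boundary of a tetrahedron winds zero times around the origin. The linear terms
  cancel by antisymmetry of \<open>d\<close>, which leaves the cubic ones.\<close>

lemma winding_cocycle:
  fixes w :: vec3 and x :: "nat \<Rightarrow> vec3"
  assumes nz: "\<And>i. cross3 w (x i) \<noteq> (0, 0, 0)"
  defines "d \<equiv> \<lambda>i j. triple w (x i) (x j)"
  shows "winding (d 1 2) (d 2 3) (d 3 1) - winding (d 0 2) (d 2 3) (d 3 0)
    + winding (d 0 1) (d 1 3) (d 3 0) - winding (d 0 1) (d 1 2) (d 2 0) = 0"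
proof -
  have swap: "d j i = - d i j" for i j unfolding d_def by (rule triple_swap)
  have deg: "\<exists>e. (e = 1 \<or> e = - 1) \<and> (\<forall>k. sgn (d j k) = e * sgn (d i k))" if "d i j = 0" for i j
    using triple_eq_0_sgn[OF nz[of i] nz[of j]] that unfolding d_def by metis
  have P: "d 0 1 * d 2 3 - d 0 2 * d 1 3 + d 0 3 * d 1 2 = 0"
    unfolding d_def by (rule triple_plucker)
  have "sgn (d 1 2) * sgn (d 2 3) * sgn (d 1 3) - sgn (d 0 2) * sgn (d 2 3) * sgn (d 0 3)
      + sgn (d 0 1) * sgn (d 1 3) * sgn (d 0 3) - sgn (d 0 1) * sgn (d 1 2) * sgn (d 0 2) = 0"
  \<comment> \<open>If some \<open>d i j\<close> vanishes, so do the two products containing it, and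
    the other two cancel because by \<open>deg\<close> the signs of rows \<open>i\<close> and
    \<open>j\<close> of \<open>d\<close> agree up to the factor \<open>e\<close>.\<close>
  proof (cases "d 0 1 \<noteq> 0 \<and> d 0 2 \<noteq> 0 \<and> d 0 3 \<noteq> 0 \<and> d 1 2 \<noteq> 0 \<and> d 1 3 \<noteq> 0 \<and> d 2 3 \<noteq> 0")
    case True
    then show ?thesis using sgn_plucker[OF P] by blast
  next
    case False
    then consider "d 0 1 = 0" | "d 0 2 = 0" | "d 0 3 = 0" | "d 1 2 = 0" | "d 1 3 = 0" | "d 2 3 = 0"
      by blast
    then show ?thesis
    proof cases
      case 1
      from deg[OF this] obtain e where "e = 1 \<or> e = - 1" "\<And>k. sgn (d 1 k) = e * sgn (d 0 k)" by blast
      with 1 show ?thesis by (auto simp del: One_nat_def)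
    next
      case 2
      from deg[OF this] obtain e where "e = 1 \<or> e = - 1" "\<And>k. sgn (d 2 k) = e * sgn (d 0 k)" by blast
      moreover from this(2)[of 1] have "sgn (d 1 2) = - e * sgn (d 0 1)"
        by (simp del: One_nat_def add: swap[of 2 1] sgn_minus)
      ultimately show ?thesis using 2 by auto
    next
      case 3
      from deg[OF this] obtain e where "e = 1 \<or> e = - 1" "\<And>k. sgn (d 3 k) = e * sgn (d 0 k)" by blast
      moreover from this(2)[of 1] this(2)[of 2]
      have "sgn (d 1 3) = - e * sgn (d 0 1)" "sgn (d 2 3) = - e * sgn (d 0 2)"
        by (simp_all del: One_nat_def add: swap[of 3 1] swap[of 3 2] sgn_minus)
      ultimately show ?thesis using 3 by auto
    next
      case 4
      from deg[OF this] obtain e where "e = 1 \<or> e = - 1" "\<And>k. sgn (d 2 k) = e * sgn (d 1 k)" by blast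
      from this(1) this(2)[of 0] this(2)[of 3] 4 show ?thesis
        by (auto simp del: One_nat_def simp: swap[of 2 0] swap[of 1 0] sgn_minus)
    next
      case 5
      from deg[OF this] obtain e where "e = 1 \<or> e = - 1" "\<And>k. sgn (d 3 k) = e * sgn (d 1 k)" by blast
      moreover from this(2)[of 0] this(2)[of 2]
      have "sgn (d 0 3) = e * sgn (d 0 1)" "sgn (d 2 3) = - e * sgn (d 1 2)"
        by (auto simp del: One_nat_def simp: swap[of 3 0] swap[of 1 0] swap[of 3 2] sgn_minus)
      ultimately show ?thesis using 5 by auto
    next
      case 6
      from deg[OF this] obtain e where "e = 1 \<or> e = - 1" "\<And>k. sgn (d 3 k) = e * sgn (d 2 k)" by blast
      from this(1) this(2)[of 0] this(2)[of 1] 6 show ?thesis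
        by (auto simp del: One_nat_def simp: swap[of 3 0] swap[of 2 0] swap[of 3 1] swap[of 2 1] sgn_minus)
    qed
  qed
  then show ?thesis
    by (simp del: One_nat_def add: winding_def swap[of 3 1] swap[of 3 0] swap[of 2 0] sgn_minus algebra_simps)
qed

section \<open>Integral matrices acting on vectors and linear forms\<close>

fun mat_act :: "int mat \<Rightarrow> vec3 \<Rightarrow> vec3" where
  "mat_act A (x, y, z) =
    (A $$ (0, 0) * x + A $$ (0, 1) * y + A $$ (0, 2) * z,
     A $$ (1, 0) * x + A $$ (1, 1) * y + A $$ (1, 2) * z,
     A $$ (2, 0) * x + A $$ (2, 1) * y + A $$ (2, 2) * z)"

text \<open>The transpose, which pulls linear forms back along \<open>mat_act A\<close>.\<close>

fun mat_coact :: "int mat \<Rightarrow> vec3 \<Rightarrow> vec3" where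
  "mat_coact A (x, y, z) =
    (A $$ (0, 0) * x + A $$ (1, 0) * y + A $$ (2, 0) * z,
     A $$ (0, 1) * x + A $$ (1, 1) * y + A $$ (2, 1) * z,
     A $$ (0, 2) * x + A $$ (1, 2) * y + A $$ (2, 2) * z)"

lemma det3:
  fixes A :: "'a::comm_ring_1 mat"
  assumes A: "A \<in> carrier_mat 3 3"
  shows "det A = A $$ (0, 0) * (A $$ (1, 1) * A $$ (2, 2) - A $$ (1, 2) * A $$ (2, 1))
    - A $$ (0, 1) * (A $$ (1, 0) * A $$ (2, 2) - A $$ (1, 2) * A $$ (2, 0))
    + A $$ (0, 2) * (A $$ (1, 0) * A $$ (2, 1) - A $$ (1, 1) * A $$ (2, 0))"
proof -
  have det2: "det B = B $$ (0, 0) * B $$ (1, 1) - B $$ (0, 1) * B $$ (1, 0)"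
    if B: "B \<in> carrier_mat 2 2" for B :: "'a mat"
  proof -
    have "det (mat_delete B 0 j) = B $$ (1, 1 - j)" if "j < 2" for j
      using that B by (subst det_single) (auto simp: mat_delete_def less_2_cases_iff)
    then show ?thesis
      by (simp add: laplace_expansion_row[OF B, of 0] cofactor_def numeral_2_eq_2)
  qed
  have del: "det (mat_delete A 0 j) = A $$ (1, if j = 0 then 1 else 0) * A $$ (2, if j = 2 then 1 else 2)
      - A $$ (1, if j = 2 then 1 else 2) * A $$ (2, if j = 0 then 1 else 0)" if "j \<in> {0, 1, 2}" for j
    using that A by (subst det2) (auto simp: mat_delete_def numeral_2_eq_2)
  have "det A = (\<Sum>j\<in>{0, 1, 2}. A $$ (0, j) * ((- 1) ^ j * det (mat_delete A 0 j)))"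
    using laplace_expansion_row[OF A, of 0] by (simp add: cofactor_def eval_nat_numeral algebra_simps)
  then show ?thesis by (simp add: del algebra_simps)
qed

lemma index_mult_mat3:
  assumes "A \<in> carrier_mat 3 3" "B \<in> carrier_mat 3 3" "i < 3" "j < 3"
  shows "(A * B) $$ (i, j) = A $$ (i, 0) * B $$ (0, j) + A $$ (i, 1) * B $$ (1, j) + A $$ (i, 2) * B $$ (2, j)"
  using assms by (simp add: scalar_prod_def numeral_3_eq_3 numeral_2_eq_2)

lemma mat_act_mult:
  assumes "A \<in> carrier_mat 3 3" "B \<in> carrier_mat 3 3"
  shows "mat_act (A * B) v = mat_act A (mat_act B v)"
  using assms by (cases v) (simp add: index_mult_mat3 del: index_mult_mat, simp add: algebra_simps)

lemma mat_coact_mult: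
  assumes "A \<in> carrier_mat 3 3" "B \<in> carrier_mat 3 3"
  shows "mat_coact (A * B) v = mat_coact B (mat_coact A v)"
  using assms by (cases v) (simp add: index_mult_mat3 del: index_mult_mat, simp add: algebra_simps)

lemma mat_act_one [simp]: "mat_act (1\<^sub>m 3) v = v"
  by (cases v) simp

lemma mat_coact_one [simp]: "mat_coact (1\<^sub>m 3) v = v"
  by (cases v) simp

lemma dot3_mat_coact: "dot3 (mat_coact A x) y = dot3 x (mat_act A y)"
  by (cases x; cases y) (simp add: algebra_simps)

lemma mat_coact_scale3: "mat_coact A (scale3 k x) = scale3 k (mat_coact A x)"
  by (cases x) (simp add: algebra_simps)

lemma triple_mat_coact:
  assumes "A \<in> carrier_mat 3 3"
  shows "triple (mat_coact A w) (mat_coact A x) (mat_coact A y) = det A * triple w x y"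
  unfolding det3[OF assms]
  by (cases w; cases x; cases y) (simp add: triple_def algebra_simps)

text \<open>\<open>gram N v\<close> is the linear form \<open>q v\<close> for the quadratic form \<open>q = N\<^sup>T N\<close>.\<close>

definition gram :: "int mat \<Rightarrow> vec3 \<Rightarrow> vec3" where
  "gram N v = mat_coact N (mat_act N v)"

lemma gram_mult:
  assumes "N \<in> carrier_mat 3 3" "A \<in> carrier_mat 3 3"
  shows "gram (N * A) v = mat_coact A (gram N (mat_act A v))"
  using assms by (simp add: gram_def mat_act_mult mat_coact_mult)

section \<open>Size estimates for vectors and forms\<close>

fun norm3 :: "vec3 \<Rightarrow> int" where
  "norm3 (x, y, z) = \<bar>x\<bar> + \<bar>y\<bar> + \<bar>z\<bar>"

lemma finite_norm3_le: "finite {v. norm3 v \<le> B}"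
proof (rule finite_subset)
  show "{v. norm3 v \<le> B} \<subseteq> {-B..B} \<times> {-B..B} \<times> {-B..B}" by auto
qed simp

lemma norm3_nonneg: "norm3 v \<ge> 0"
  by (cases v) simp

lemma norm3_pos: "v \<noteq> (0, 0, 0) \<Longrightarrow> norm3 v > 0"
  by (cases v) auto

lemma norm3_add: "norm3 (a + b) \<le> norm3 a + norm3 b"
  by (cases a; cases b) auto

lemma norm3_scale3: "norm3 (scale3 k v) = \<bar>k\<bar> * norm3 v"
  by (cases v) (simp add: abs_mult distrib_left)

lemma norm3_square_le: "(norm3 v)\<^sup>2 \<le> 3 * dot3 v v"
proof -
  obtain x y z where v: "v = (x, y, z)" by (cases v)
  have "3 * (x * x + y * y + z * z) - (\<bar>x\<bar> + \<bar>y\<bar> + \<bar>z\<bar>)\<^sup>2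
      = (\<bar>x\<bar> - \<bar>y\<bar>)\<^sup>2 + (\<bar>y\<bar> - \<bar>z\<bar>)\<^sup>2 + (\<bar>x\<bar> - \<bar>z\<bar>)\<^sup>2"
    by (simp add: power2_eq_square algebra_simps)
  moreover have "\<dots> \<ge> 0" by simp
  ultimately have "(\<bar>x\<bar> + \<bar>y\<bar> + \<bar>z\<bar>)\<^sup>2 \<le> 3 * (x * x + y * y + z * z)" by linarith
  then show ?thesis by (simp add: v)
qed

lemma dot3_self_nonneg: "dot3 v v \<ge> 0"
  by (cases v) simp

lemma lin3_bound:
  fixes a b c x y z :: int
  shows "\<bar>a * x + b * y + c * z\<bar> \<le> (\<bar>a\<bar> + \<bar>b\<bar> + \<bar>c\<bar>) * (\<bar>x\<bar> + \<bar>y\<bar> + \<bar>z\<bar>)"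
proof -
  have "\<bar>a * x + b * y + c * z\<bar> \<le> \<bar>a\<bar> * \<bar>x\<bar> + \<bar>b\<bar> * \<bar>y\<bar> + \<bar>c\<bar> * \<bar>z\<bar>"
    using abs_triangle_ineq[of "a * x + b * y" "c * z"] abs_triangle_ineq[of "a * x" "b * y"]
    by (simp add: abs_mult)
  also have "\<dots> \<le> (\<bar>a\<bar> + \<bar>b\<bar> + \<bar>c\<bar>) * (\<bar>x\<bar> + \<bar>y\<bar> + \<bar>z\<bar>)"
    by (simp add: algebra_simps)
  finally show ?thesis .
qed

lemma mat_act_bound: "\<exists>K. \<forall>v. norm3 (mat_act A v) \<le> K * norm3 v"
proof -
  define r where "r i = \<bar>A $$ (i, 0)\<bar> + \<bar>A $$ (i, 1)\<bar> + \<bar>A $$ (i, 2)\<bar>" for i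
  have "norm3 (mat_act A (x, y, z)) \<le> (r 0 + r 1 + r 2) * norm3 (x, y, z)" for x y z
    using lin3_bound[of "A $$ (0, 0)" x "A $$ (0, 1)" y "A $$ (0, 2)" z]
      lin3_bound[of "A $$ (1, 0)" x "A $$ (1, 1)" y "A $$ (1, 2)" z]
      lin3_bound[of "A $$ (2, 0)" x "A $$ (2, 1)" y "A $$ (2, 2)" z]
    unfolding mat_act.simps norm3.simps r_def by (simp only: distrib_right)
  then show ?thesis by (metis prod_cases3)
qed

lemma mat_coact_bound: "\<exists>K. \<forall>v. norm3 (mat_coact A v) \<le> K * norm3 v"
proof -
  define r where "r i = \<bar>A $$ (0, i)\<bar> + \<bar>A $$ (1, i)\<bar> + \<bar>A $$ (2, i)\<bar>" for i
  have "norm3 (mat_coact A (x, y, z)) \<le> (r 0 + r 1 + r 2) * norm3 (x, y, z)" for x y z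
    using lin3_bound[of "A $$ (0, 0)" x "A $$ (1, 0)" y "A $$ (2, 0)" z]
      lin3_bound[of "A $$ (0, 1)" x "A $$ (1, 1)" y "A $$ (2, 1)" z]
      lin3_bound[of "A $$ (0, 2)" x "A $$ (1, 2)" y "A $$ (2, 2)" z]
    unfolding mat_coact.simps norm3.simps r_def by (simp only: distrib_right)
  then show ?thesis by (metis prod_cases3)
qed

lemma norm3_bound_mono:
  assumes "\<forall>v. norm3 (f v) \<le> K * norm3 (g v)" "K \<le> L"
  shows "norm3 (f v) \<le> L * norm3 (g v)"
  using assms mult_right_mono[OF assms(2) norm3_nonneg[of "g v"]] order_trans by blast

lemma gram_bound: "\<exists>K. \<forall>v. norm3 (gram N v) \<le> K * norm3 v"
proof -
  obtain K where K: "\<forall>v. norm3 (mat_act N v) \<le> K * norm3 v" using mat_act_bound by blast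
  obtain L where L: "\<forall>v. norm3 (mat_coact N v) \<le> L * norm3 v" using mat_coact_bound by blast
  have "norm3 (gram N v) \<le> \<bar>L\<bar> * K * norm3 v" for v
  proof -
    have "norm3 (gram N v) \<le> \<bar>L\<bar> * norm3 (mat_act N v)"
      unfolding gram_def by (rule norm3_bound_mono[OF L]) simp
    also have "\<dots> \<le> \<bar>L\<bar> * (K * norm3 v)" by (intro mult_left_mono K[rule_format]) simp
    finally show ?thesis by (simp add: mult.assoc)
  qed
  then show ?thesis by blast
qed

text \<open>\<open>M\<close> recovers \<open>v\<close> from \<open>mat_act N v\<close>, whose
  squared Euclidean length is \<open>dot3 (gram N v) v\<close>.\<close>

lemma gram_lower_bound:
  assumes "N \<in> carrier_mat 3 3" "M \<in> carrier_mat 3 3" "M * N = 1\<^sub>m 3"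
  shows "\<exists>K\<ge>0. \<forall>v. (norm3 v)\<^sup>2 \<le> K * dot3 (gram N v) v"
proof -
  obtain K where K: "\<forall>v. norm3 (mat_act M v) \<le> K * norm3 v" using mat_act_bound by blast
  have "(norm3 v)\<^sup>2 \<le> (K\<^sup>2 * 3) * dot3 (gram N v) v" for v
  proof -
    have "mat_act M (mat_act N v) = v"
      using mat_act_mult[OF assms(2,1), of v] assms(3) by simp
    then have "norm3 v \<le> K * norm3 (mat_act N v)" using K by metis
    then have "(norm3 v)\<^sup>2 \<le> (K * norm3 (mat_act N v))\<^sup>2"
      using norm3_nonneg by (intro power_mono)
    also have "\<dots> \<le> K\<^sup>2 * (3 * dot3 (mat_act N v) (mat_act N v))"
      unfolding power_mult_distrib by (intro mult_left_mono norm3_square_le) simp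
    finally show ?thesis by (simp add: gram_def dot3_mat_coact)
  qed
  then show ?thesis by (intro exI[of _ "K\<^sup>2 * 3"]) simp
qed

section \<open>Counting crossings\<close>

definition e3_mod3 :: "vec3 \<Rightarrow> bool" where
  "e3_mod3 v = (case v of (a, b, c) \<Rightarrow> 3 dvd a \<and> 3 dvd b \<and> 3 dvd c - 1)"

definition frames :: "(vec3 \<times> vec3) set" where
  "frames = {(v, w). dot3 w v = 1 \<and> e3_mod3 v \<and> e3_mod3 w}"

definition frame_winding :: "int mat \<Rightarrow> int mat \<Rightarrow> int mat \<Rightarrow> vec3 \<times> vec3 \<Rightarrow> int" where
  "frame_winding L M N = (\<lambda>(v, w). winding (triple w (gram L v) (gram M v))
    (triple w (gram M v) (gram N v)) (triple w (gram N v) (gram L v)))"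

text \<open>Up to a common sign, the determinants of opposite pairs of vertices are barycentric
  weights of the origin modulo \<open>w\<close>. By \<open>triple_cramer\<close>, the form with
  these weights therefore sends \<open>v\<close> to a multiple of \<open>w\<close>.\<close>

lemma frame_winding_neq_0D:
  assumes "frame_winding L M N (v, w) \<noteq> 0"
  obtains p q r l where "p \<ge> 0" "q \<ge> 0" "r \<ge> 0" "p + q + r > 0"
    "\<And>z. p * dot3 (gram L v) z + q * dot3 (gram M v) z + r * dot3 (gram N v) z = l * dot3 w z"
proof -
  define d where "d s = s * triple w (gram M v) (gram N v)" for s
  define e where "e s = s * triple w (gram N v) (gram L v)" for s
  define f where "f s = s * triple w (gram L v) (gram M v)" for s
  have "\<exists>s\<in>{1, - 1}. d s \<ge> 0 \<and> e s \<ge> 0 \<and> f s \<ge> 0 \<and> d s + e s + f s > 0"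
    using winding_neq_0D[of "f 1" "d 1" "e 1"] assms
    by (auto simp: frame_winding_def d_def e_def f_def)
  then obtain s where s: "d s \<ge> 0" "e s \<ge> 0" "f s \<ge> 0" "d s + e s + f s > 0" by blast
  show thesis
  proof (rule that[OF s, of "s * triple (gram L v) (gram M v) (gram N v)"])
    fix z
    show "d s * dot3 (gram L v) z + e s * dot3 (gram M v) z + f s * dot3 (gram N v) z
        = s * triple (gram L v) (gram M v) (gram N v) * dot3 w z"
      using arg_cong[OF triple_cramer[of w "gram M v" "gram N v" "gram L v" z], of "\<lambda>t. s * t"]
      unfolding d_def e_def f_def by (simp only: distrib_left mult.assoc)
  qed
qed

lemma dot3_add_left: "dot3 (a + b) z = dot3 a z + dot3 b z"
  by (cases a; cases b; cases z) (simp add: algebra_simps)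

lemma dot3_scale3_left: "dot3 (scale3 k a) z = k * dot3 a z"
  by (cases a; cases z) (simp add: algebra_simps)

lemma dot3_eqI:
  assumes "\<And>z. dot3 a z = dot3 b z"
  shows "a = b"
  using assms[of "(1, 0, 0)"] assms[of "(0, 1, 0)"] assms[of "(0, 0, 1)"]
  by (cases a; cases b) simp

text \<open>For a contributing frame, a combination of the three forms with total weight
  \<open>S > 0\<close> sends \<open>v\<close> to \<open>l\<close> times \<open>w\<close>. Pairing
  with \<open>v\<close> gives \<open>S * (norm3 v)^2 \<le> k * l\<close>, and comparing norms gives
  \<open>\<bar>l\<bar> * norm3 w \<le> S * H * norm3 v\<close>. Together they bound
  \<open>norm3 v * norm3 w\<close> by \<open>k * H\<close>.\<close>

lemma finite_frame_winding:
  assumes "L \<in> carrier (SL 3)" "M \<in> carrier (SL 3)" "N \<in> carrier (SL 3)"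
  shows "finite {p \<in> frames. frame_winding L M N p \<noteq> 0}"
proof -
  have lower: "\<exists>K\<ge>0. \<forall>v. (norm3 v)\<^sup>2 \<le> K * dot3 (gram A v) v" if A: "A \<in> carrier (SL 3)" for A
  proof -
    interpret group "SL 3 :: int mat monoid" by (rule group_SL)
    have "inv\<^bsub>SL 3\<^esub> A \<in> carrier (SL 3)" "inv\<^bsub>SL 3\<^esub> A \<otimes>\<^bsub>SL 3\<^esub> A = \<one>\<^bsub>SL 3\<^esub>"
      using A by simp_all
    then show ?thesis using A by (intro gram_lower_bound[of A "inv\<^bsub>SL 3\<^esub> A"]) (auto simp: SL_def)
  qed
  obtain kL kM kN where kk: "kL \<ge> 0" "kM \<ge> 0" "kN \<ge> 0"
    "\<forall>v. (norm3 v)\<^sup>2 \<le> kL * dot3 (gram L v) v" "\<forall>v. (norm3 v)\<^sup>2 \<le> kM * dot3 (gram M v) v"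
    "\<forall>v. (norm3 v)\<^sup>2 \<le> kN * dot3 (gram N v) v"
    using lower assms by metis
  obtain hL hM hN where h: "\<forall>v. norm3 (gram L v) \<le> hL * norm3 v"
    "\<forall>v. norm3 (gram M v) \<le> hM * norm3 v" "\<forall>v. norm3 (gram N v) \<le> hN * norm3 v"
    using gram_bound by metis
  define k where "k = kL + kM + kN"
  define H where "H = \<bar>hL\<bar> + \<bar>hM\<bar> + \<bar>hN\<bar>"
  have k0: "k \<ge> 0" using kk(1-3) by (simp add: k_def)
  have k: "(norm3 v)\<^sup>2 \<le> k * dot3 (gram A v) v" if "A \<in> {L, M, N}" for A v
  proof -
    have "0 \<le> dot3 (gram A v) v"
      unfolding gram_def dot3_mat_coact by (rule dot3_self_nonneg)
    then have "kL * dot3 (gram A v) v \<le> k * dot3 (gram A v) v"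
      "kM * dot3 (gram A v) v \<le> k * dot3 (gram A v) v"
      "kN * dot3 (gram A v) v \<le> k * dot3 (gram A v) v"
      using kk(1-3) by (auto intro!: mult_right_mono simp: k_def)
    then show ?thesis using that kk(4-6)[rule_format, of v] by auto
  qed
  have H: "norm3 (gram A v) \<le> H * norm3 v" if "A \<in> {L, M, N}" for A v
    using that norm3_bound_mono[OF h(1), of H v] norm3_bound_mono[OF h(2), of H v]
      norm3_bound_mono[OF h(3), of H v]
    by (auto simp: H_def)
  have "norm3 v \<le> k * H \<and> norm3 w \<le> k * H"
    if f: "(v, w) \<in> frames" and nz: "frame_winding L M N (v, w) \<noteq> 0" for v w
  proof -
    from nz obtain p q r l where pqr: "p \<ge> 0" "q \<ge> 0" "r \<ge> 0" "p + q + r > 0"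
      and e: "\<And>z. p * dot3 (gram L v) z + q * dot3 (gram M v) z + r * dot3 (gram N v) z = l * dot3 w z"
      using frame_winding_neq_0D by metis
    let ?S = "p + q + r"
    have wv: "dot3 w v = 1" using f by (simp add: frames_def)
    have v: "norm3 v > 0" and w: "norm3 w > 0"
      using wv by (auto intro!: norm3_pos)
    have "?S * (norm3 v)\<^sup>2 \<le> p * (k * dot3 (gram L v) v) + q * (k * dot3 (gram M v) v)
        + r * (k * dot3 (gram N v) v)"
      unfolding distrib_right using pqr by (intro add_mono mult_left_mono k) auto
    also have "\<dots> = k * l" using e[of v] wv by (simp add: algebra_simps) (simp add: distrib_left[symmetric] add.assoc)
    finally have 1: "?S * (norm3 v)\<^sup>2 \<le> k * l" .
    have "scale3 p (gram L v) + scale3 q (gram M v) + scale3 r (gram N v) = scale3 l w"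
      by (rule dot3_eqI) (simp add: dot3_add_left dot3_scale3_left e)
    then have "\<bar>l\<bar> * norm3 w = norm3 (scale3 p (gram L v) + scale3 q (gram M v) + scale3 r (gram N v))"
      by (simp add: norm3_scale3)
    also have "\<dots> \<le> p * norm3 (gram L v) + q * norm3 (gram M v) + r * norm3 (gram N v)"
      using pqr norm3_add[of "scale3 p (gram L v) + scale3 q (gram M v)" "scale3 r (gram N v)"]
        norm3_add[of "scale3 p (gram L v)" "scale3 q (gram M v)"]
      by (simp add: norm3_scale3)
    also have "\<dots> \<le> p * (H * norm3 v) + q * (H * norm3 v) + r * (H * norm3 v)"
      using pqr by (intro add_mono mult_left_mono H) auto
    finally have 2: "\<bar>l\<bar> * norm3 w \<le> ?S * (H * norm3 v)" by (simp add: algebra_simps)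
    have "(?S * norm3 v) * (norm3 v * norm3 w) = ?S * (norm3 v)\<^sup>2 * norm3 w"
      by (simp add: power2_eq_square)
    also have "\<dots> \<le> (k * \<bar>l\<bar>) * norm3 w"
      using 1 k0 w by (intro mult_right_mono order_trans[OF 1] mult_left_mono) auto
    also have "\<dots> \<le> k * (?S * (H * norm3 v))"
      unfolding mult.assoc using 2 k0 by (rule mult_left_mono)
    also have "\<dots> = (?S * norm3 v) * (k * H)" by simp
    finally have "norm3 v * norm3 w \<le> k * H"
      using pqr(4) v by (simp add: mult_le_cancel_left)
    moreover have "norm3 v * 1 \<le> norm3 v * norm3 w" "1 * norm3 w \<le> norm3 v * norm3 w"
      using v w by (intro mult_left_mono mult_right_mono; simp)+
    ultimately show ?thesis by simp
  qed
  then have "{p \<in> frames. frame_winding L M N p \<noteq> 0} \<subseteq> {v. norm3 v \<le> k * H} \<times> {w. norm3 w \<le> k * H}"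
    by auto
  then show ?thesis by (rule finite_subset) (simp add: finite_norm3_le)
qed

text \<open>The sum over all frames, written over its support, which is finite for matrices in
  \<open>SL 3\<close>.\<close>

definition crossing :: "int mat \<Rightarrow> int mat \<Rightarrow> int mat \<Rightarrow> int" where
  "crossing L M N = (\<Sum>p | p \<in> frames \<and> frame_winding L M N p \<noteq> 0. frame_winding L M N p)"

text \<open>Brings the crossings of several triangles to one common index set.\<close>

lemma crossing_eq_sum:
  assumes "finite S" "{p \<in> frames. frame_winding L M N p \<noteq> 0} \<subseteq> S" "S \<subseteq> frames"
  shows "crossing L M N = sum (frame_winding L M N) S"
  unfolding crossing_def using assms by (intro sum.mono_neutral_left) auto

section \<open>The congruence subgroup of level three\<close>

definition congruence3 :: "int mat set" where
  "congruence3 = kernel (SL 3) (SL 3) (map_mat (of_int :: int \<Rightarrow> 3))"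

lemma of_int3_eq_0: "(of_int k :: 3) = 0 \<longleftrightarrow> 3 dvd k"
  by (simp add: of_int_eq_0_iff_char_dvd)

lemma e3_mod3_iff:
  "e3_mod3 (a, b, c) \<longleftrightarrow> (of_int a :: 3) = 0 \<and> (of_int b :: 3) = 0 \<and> (of_int c :: 3) = 1"
  using of_int3_eq_0[of "c - 1"] by (simp add: e3_mod3_def of_int3_eq_0)

lemma subgroup_congruence3: "subgroup congruence3 (SL 3)"
proof -
  have "map_mat of_int \<in> hom (SL 3 :: int mat monoid) (SL 3 :: 3 mat monoid)"
    by (auto simp: hom_def SL_def of_int_hom.hom_det of_int_hom.mat_hom_mult[of _ 3 3 _ 3])
  then show ?thesis
    unfolding congruence3_def
    by (intro group_hom.subgroup_kernel) (simp add: group_hom_def group_hom_axioms_def group_SL)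
qed

lemma congruence3_carrier: "A \<in> congruence3 \<Longrightarrow> A \<in> carrier_mat 3 3"
  by (simp add: congruence3_def kernel_def SL_def)

lemma congruence3_det: "A \<in> congruence3 \<Longrightarrow> det A = 1"
  by (simp add: congruence3_def kernel_def SL_def)

lemma congruence3_SL: "A \<in> congruence3 \<Longrightarrow> A \<in> carrier (SL 3)"
  by (simp add: congruence3_def kernel_def)

lemma congruence3_mult: "A \<in> congruence3 \<Longrightarrow> B \<in> congruence3 \<Longrightarrow> A * B \<in> congruence3"
  using subgroup.m_closed[OF subgroup_congruence3] by (simp add: SL_def)

lemma congruence3_one: "1\<^sub>m 3 \<in> congruence3"
  using subgroup.one_closed[OF subgroup_congruence3] by (simp add: SL_def)

lemma congruence3_inverse:
  assumes "A \<in> congruence3"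
  obtains B where "B \<in> congruence3" "A * B = 1\<^sub>m 3" "B * A = 1\<^sub>m 3"
proof
  interpret group "SL 3 :: int mat monoid" by (rule group_SL)
  show "inv\<^bsub>SL 3\<^esub> A \<in> congruence3"
    using subgroup.m_inv_closed[OF subgroup_congruence3 assms] .
  show "A * inv\<^bsub>SL 3\<^esub> A = 1\<^sub>m 3" "inv\<^bsub>SL 3\<^esub> A * A = 1\<^sub>m 3"
    using r_inv[OF congruence3_SL[OF assms]] l_inv[OF congruence3_SL[OF assms]]
    by (simp_all add: SL_def)
qed

lemma congruence3_index:
  assumes "A \<in> congruence3" "i < 3" "j < 3"
  shows "(of_int (A $$ (i, j)) :: 3) = (if i = j then 1 else 0)"
proof -
  have "map_mat of_int A = (1\<^sub>m 3 :: 3 mat)" and "A \<in> carrier_mat 3 3"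
    using assms(1) by (auto simp: congruence3_def kernel_def SL_def)
  then show ?thesis using assms(2,3) by (metis carrier_matD index_map_mat(1) index_one_mat(1))
qed

lemma e3_mod3_mat_act: "A \<in> congruence3 \<Longrightarrow> e3_mod3 v \<Longrightarrow> e3_mod3 (mat_act A v)"
  by (cases v) (simp add: e3_mod3_iff congruence3_index)

lemma e3_mod3_mat_coact: "A \<in> congruence3 \<Longrightarrow> e3_mod3 v \<Longrightarrow> e3_mod3 (mat_coact A v)"
  by (cases v) (simp add: e3_mod3_iff congruence3_index)

lemma frames_act:
  assumes "A \<in> congruence3" "B \<in> congruence3" "B * A = 1\<^sub>m 3" "(v, w) \<in> frames"
  shows "(mat_act A v, mat_coact B w) \<in> frames"
  using assms mat_act_mult[of B A v, OF congruence3_carrier congruence3_carrier]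
  by (simp add: frames_def dot3_mat_coact e3_mod3_mat_act e3_mod3_mat_coact)

text \<open>By \<open>gram_mult\<close> both arguments of each \<open>triple\<close> carry a factor
  \<open>mat_coact A\<close>, and so does \<open>w\<close>, as the image of
  \<open>mat_coact B w\<close>. The factor disappears because \<open>det A = 1\<close>.\<close>

lemma frame_winding_act:
  assumes "A \<in> congruence3" "B \<in> congruence3" "B * A = 1\<^sub>m 3"
    and "L \<in> carrier_mat 3 3" "M \<in> carrier_mat 3 3" "N \<in> carrier_mat 3 3"
  shows "frame_winding (L * A) (M * A) (N * A) (v, w)
    = frame_winding L M N (mat_act A v, mat_coact B w)"
proof -
  note A = congruence3_carrier[OF assms(1)] and B = congruence3_carrier[OF assms(2)]
  have "w = mat_coact A (mat_coact B w)"
    using mat_coact_mult[OF B A, of w] assms(3) by simp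
  then have "triple w (gram (X * A) v) (gram (Y * A) v)
      = triple (mat_coact B w) (gram X (mat_act A v)) (gram Y (mat_act A v))"
    if "X \<in> carrier_mat 3 3" "Y \<in> carrier_mat 3 3" for X Y
    using that A congruence3_det[OF assms(1)] triple_mat_coact[OF A, of "mat_coact B w"]
    by (simp add: gram_mult)
  with assms(4-6) show ?thesis by (simp add: frame_winding_def)
qed

text \<open>\<open>A\<close> permutes the frames and preserves their contributions, so this is a
  reindexing of the sum.\<close>

lemma crossing_act:
  assumes "A \<in> congruence3"
    and "L \<in> carrier_mat 3 3" "M \<in> carrier_mat 3 3" "N \<in> carrier_mat 3 3"
  shows "crossing (L * A) (M * A) (N * A) = crossing L M N"
proof -
  obtain B where B: "B \<in> congruence3" "A * B = 1\<^sub>m 3" "B * A = 1\<^sub>m 3"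
    using congruence3_inverse[OF assms(1)] .
  note cA = congruence3_carrier[OF assms(1)] and cB = congruence3_carrier[OF B(1)]
  have inv: "mat_act A (mat_act B v) = v" "mat_act B (mat_act A v) = v"
    "mat_coact A (mat_coact B v) = v" "mat_coact B (mat_coact A v) = v" for v
    using mat_act_mult[OF cA cB, of v] mat_act_mult[OF cB cA, of v]
      mat_coact_mult[OF cA cB, of v] mat_coact_mult[OF cB cA, of v] B by simp_all
  note act = frame_winding_act[OF assms(1) B(1,3) assms(2-4)]
  show ?thesis
    unfolding crossing_def
  proof (rule sum.reindex_bij_witness[of _ "\<lambda>(v, w). (mat_act B v, mat_coact A w)"
          "\<lambda>(v, w). (mat_act A v, mat_coact B w)"], goal_cases)
    case (1 p)
    then show ?case by (cases p) (simp only: prod.case inv)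
  next
    case (2 p)
    obtain v w where "p = (v, w)" by (cases p)
    with 2 show ?case using frames_act[OF assms(1) B(1,3), of v w] by (simp add: act)
  next
    case (3 p)
    then show ?case by (cases p) (simp only: prod.case inv)
  next
    case (4 p)
    obtain v w where "p = (v, w)" by (cases p)
    with 4 show ?case using frames_act[OF B(1) assms(1) B(2), of v w] by (simp add: act inv)
  next
    case (5 p)
    then show ?case by (cases p) (simp only: prod.case act)
  qed
qed

section \<open>Unipotent matrices\<close>

text \<open>The product of the commuting elementary matrices \<open>e_13(x)\<close> and
  \<open>e_23(y)\<close>.\<close>

definition unip :: "'a::comm_ring_1 \<Rightarrow> 'a \<Rightarrow> 'a mat" where
  "unip x y = mat 3 3 (\<lambda>(i, j). if i = j then 1 else if j = 2 then (if i = 0 then x else y) else 0)"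

lemma unip_carrier [simp]: "unip x y \<in> carrier_mat 3 3"
  by (simp add: unip_def)

lemma unip_index: "i < 3 \<Longrightarrow> j < 3 \<Longrightarrow>
    unip x y $$ (i, j) = (if i = j then 1 else if j = 2 then (if i = 0 then x else y) else 0)"
  by (simp add: unip_def)

lemma det_unip [simp]: "det (unip x y) = 1"
  by (subst det3) (simp_all add: unip_index)

lemma unip_mult: "unip a b * unip c d = unip (a + c) (b + d)"
  by (rule eq_matI)
    (auto simp: index_mult_mat3 unip_index carrier_matD[OF unip_carrier] simp del: index_mult_mat(1)
      dest!: less_Suc_eq[THEN iffD1, unfolded numeral_3_eq_3[symmetric]])

lemma unip_SL: "unip x y \<in> carrier (SL 3)"
  by (simp add: SL_def)

lemma gram_unip:
  "gram (unip x y) (a, b, c) = (a + x * c, b + y * c, x * (a + x * c) + y * (b + y * c) + c)"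
  by (simp add: gram_def unip_index)

lemma unip_congruence3:
  assumes "3 dvd x" "3 dvd y"
  shows "unip x y \<in> congruence3"
proof -
  have "map_mat of_int (unip x y) = (1\<^sub>m 3 :: 3 mat)"
    using assms by (intro eq_matI) (auto simp: unip_def of_int3_eq_0)
  then show ?thesis by (simp add: congruence3_def kernel_def SL_def)
qed

text \<open>Forms in the convex hull of the \<open>unip x y\<close>-translates of the standard form lie deep in the
  cusp of the unipotent group, where only frames with a fixed second component are orthogonal.\<close>

lemma unip_hull_orthogonal:
  fixes x :: "nat \<Rightarrow> int" and y :: "nat \<Rightarrow> int"
  assumes pqr: "p \<ge> 0" "q \<ge> 0" "r \<ge> 0" "p + q + r > 0"
    and e: "\<And>z. p * dot3 (gram (unip (x 0) (y 0)) v) z + q * dot3 (gram (unip (x 1) (y 1)) v) z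
      + r * dot3 (gram (unip (x 2) (y 2)) v) z = l * dot3 w z"
    and f: "(v, w) \<in> frames"
  shows "\<exists>a b. v = (a, b, 1) \<and> w = (0, 0, 1) \<and> 3 dvd a \<and> 3 dvd b"
proof -
  obtain a b c where v: "v = (a, b, c)" by (cases v)
  obtain g h k where w: "w = (g, h, k)" by (cases w)
  define X where "X i = a + x i * c" for i
  define Y where "Y i = b + y i * c" for i
  let ?S = "p + q + r"
  have wv: "g * a + h * b + k * c = 1" using f by (simp add: frames_def v w)
  have m: "3 dvd a" "3 dvd b" "3 dvd c - 1" "3 dvd k - 1"
    using f by (auto simp: frames_def e3_mod3_def v w)
  have c: "c\<^sup>2 \<ge> 1"
  proof -
    have "c \<noteq> 0" using m(3) by auto
    then have "c\<^sup>2 > 0" by simp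
    then show ?thesis by linarith
  qed
  have g: "l * g = p * X 0 + q * X 1 + r * X 2"
    using e[of "(1, 0, 0)"] by (simp add: v w gram_unip X_def)
  have h: "l * h = p * Y 0 + q * Y 1 + r * Y 2"
    using e[of "(0, 1, 0)"] by (simp add: v w gram_unip Y_def)
  have "dot3 (gram (unip (x i) (y i)) v) v = (X i)\<^sup>2 + (Y i)\<^sup>2 + c\<^sup>2" for i
    by (simp add: v gram_unip X_def Y_def power2_eq_square algebra_simps)
  then have l: "l = p * ((X 0)\<^sup>2 + (Y 0)\<^sup>2 + c\<^sup>2) + q * ((X 1)\<^sup>2 + (Y 1)\<^sup>2 + c\<^sup>2)
      + r * ((X 2)\<^sup>2 + (Y 2)\<^sup>2 + c\<^sup>2)"
    using e[of v] wv by (simp add: v w)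
  \<comment> \<open>Used for \<open>Z = X\<close> and \<open>Z = Y\<close>. If \<open>u\<close> were
    nonzero, then \<open>l^2 \<le> (l * u)^2\<close>, and weighted Cauchy-Schwarz with
    \<open>c^2 \<ge> 1\<close> bounds the latter by \<open>S * (l - S)\<close>, where
    \<open>S = p + q + r\<close>. But \<open>l^2 - S * l + S^2\<close> is positive for
    \<open>S > 0\<close>.\<close>
  have zero: "u = 0" if u: "l * u = p * Z 0 + q * Z 1 + r * Z 2"
    and Z: "\<And>i. (Z i)\<^sup>2 \<le> (X i)\<^sup>2 + (Y i)\<^sup>2" for u and Z :: "nat \<Rightarrow> int"
  proof (rule ccontr)
    assume "u \<noteq> 0"
    then have "u\<^sup>2 > 0" by simp
    then have "1 \<le> u\<^sup>2" by linarith
    then have "l\<^sup>2 * 1 \<le> l\<^sup>2 * u\<^sup>2" by (intro mult_left_mono) auto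
    also have "\<dots> = (p * Z 0 + q * Z 1 + r * Z 2)\<^sup>2"
      using u by (simp add: power_mult_distrib[symmetric])
    also have "\<dots> \<le> ?S * (p * (Z 0)\<^sup>2 + q * (Z 1)\<^sup>2 + r * (Z 2)\<^sup>2)"
    proof -
      have "?S * (p * (Z 0)\<^sup>2 + q * (Z 1)\<^sup>2 + r * (Z 2)\<^sup>2) - (p * Z 0 + q * Z 1 + r * Z 2)\<^sup>2
          = p * q * (Z 0 - Z 1)\<^sup>2 + p * r * (Z 0 - Z 2)\<^sup>2 + q * r * (Z 1 - Z 2)\<^sup>2"
        by (simp add: power2_eq_square algebra_simps)
      moreover have "\<dots> \<ge> 0" using pqr by simp
      ultimately show ?thesis by linarith
    qed
    also have "\<dots> \<le> ?S * (l - ?S)"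
    proof (intro mult_left_mono)
      have le: "(Z i)\<^sup>2 + 1 \<le> (X i)\<^sup>2 + (Y i)\<^sup>2 + c\<^sup>2" for i using Z[of i] c by linarith
      have "p * ((Z 0)\<^sup>2 + 1) + q * ((Z 1)\<^sup>2 + 1) + r * ((Z 2)\<^sup>2 + 1) \<le> l"
        unfolding l using mult_left_mono[OF le[of 0] pqr(1)] mult_left_mono[OF le[of 1] pqr(2)]
          mult_left_mono[OF le[of 2] pqr(3)] by linarith
      then show "p * (Z 0)\<^sup>2 + q * (Z 1)\<^sup>2 + r * (Z 2)\<^sup>2 \<le> l - ?S" by (simp add: algebra_simps)
    qed (use pqr in simp)
    finally have "l\<^sup>2 - ?S * l + ?S\<^sup>2 \<le> 0" by (simp add: power2_eq_square algebra_simps)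
    then have "(2 * l - ?S)\<^sup>2 + 3 * ?S\<^sup>2 \<le> 0" by (simp add: power2_eq_square algebra_simps)
    moreover have "?S\<^sup>2 > 0" using pqr(4) by simp
    ultimately show False using zero_le_power2[of "2 * l - ?S"] by linarith
  qed
  have "g = 0" "h = 0" by (rule zero[OF g], simp, rule zero[OF h], simp)
  then have "k * c = 1" using wv by simp
  \<comment> \<open>The congruences modulo 3 exclude \<open>k = c = - 1\<close>.\<close>
  then have "k = 1 \<and> c = 1"
    using m(3,4) by (auto simp: zmult_eq_1_iff)
  with \<open>g = 0\<close> \<open>h = 0\<close> m show ?thesis by (simp add: v w)
qed

section \<open>The crossing cocycle\<close>

lemma cross3_scale3_same [simp]: "cross3 w (scale3 k w) = (0, 0, 0)"
  by (cases w) (simp add: algebra_simps)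

text \<open>A degenerate pair would be orthogonal for the base form itself, hence of the shape
  \<open>(a, b, 1)\<close>, \<open>(0, 0, 1)\<close>. The offset 1 in \<open>unip 1 2\<close> then
  forces \<open>a = - 1\<close>, which is not a multiple of 3.\<close>

lemma base_nondegenerate:
  assumes "(v, w) \<in> frames"
  shows "cross3 w (gram (unip 1 2) v) \<noteq> (0, 0, 0)"
proof
  assume "cross3 w (gram (unip 1 2) v) = (0, 0, 0)"
  moreover have "dot3 w v = 1" using assms by (simp add: frames_def)
  ultimately obtain l where l: "gram (unip 1 2) v = scale3 l w" using cross3_eq_0D by blast
  have "\<exists>a b. v = (a, b, 1) \<and> w = (0, 0, 1) \<and> 3 dvd a \<and> 3 dvd b"
    using unip_hull_orthogonal[of 1 0 0 "\<lambda>_. 1" "\<lambda>_. 2" v l w] l assms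
    by (simp add: dot3_scale3_left)
  then obtain a b where ab: "v = (a, b, 1)" "w = (0, 0, 1)" "3 dvd a" by blast
  with l have "a + 1 = 0" by (simp add: gram_unip)
  then have "a = - 1" by simp
  with ab(3) show False by simp
qed

text \<open>The action of \<open>A\<close> carries a degenerate frame for the translated form to one
  for the base form.\<close>

lemma frames_nondegenerate:
  assumes "A \<in> congruence3" "(v, w) \<in> frames"
  shows "cross3 w (gram (unip 1 2 * A) v) \<noteq> (0, 0, 0)"
proof
  assume c: "cross3 w (gram (unip 1 2 * A) v) = (0, 0, 0)"
  obtain B where B: "B \<in> congruence3" "A * B = 1\<^sub>m 3" "B * A = 1\<^sub>m 3"
    using congruence3_inverse[OF assms(1)] .
  note cA = congruence3_carrier[OF assms(1)] and cB = congruence3_carrier[OF B(1)]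
  have "dot3 w v = 1" using assms(2) by (simp add: frames_def)
  then obtain l where l: "gram (unip 1 2 * A) v = scale3 l w" using cross3_eq_0D[OF c] by blast
  have "gram (unip 1 2) (mat_act A v) = mat_coact B (gram (unip 1 2 * A) v)"
    using cA mat_coact_mult[OF cA cB, of "gram (unip 1 2) (mat_act A v)"] B(2) by (simp add: gram_mult)
  also have "\<dots> = scale3 l (mat_coact B w)" by (simp add: l mat_coact_scale3)
  finally show False
    using base_nondegenerate[OF frames_act[OF assms(1) B(1,3) assms(2)]] by simp
qed

text \<open>\<open>winding_cocycle\<close> holds frame by frame; sum it over the union of the four
  supports.\<close>

lemma crossing_cocycle:
  assumes "L \<in> congruence3" "M \<in> congruence3" "N \<in> congruence3" "P \<in> congruence3"
  defines "t \<equiv> \<lambda>A. unip 1 2 * A"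
  shows "crossing (t M) (t N) (t P) - crossing (t L) (t N) (t P)
    + crossing (t L) (t M) (t P) - crossing (t L) (t M) (t N) = 0"
proof -
  have SL: "t A \<in> carrier (SL 3)" if "A \<in> congruence3" for A
    using monoid.m_closed[OF group.is_monoid[OF group_SL] unip_SL congruence3_SL[OF that]]
    by (simp add: t_def SL_def)
  let ?s = "\<lambda>A B C. {p \<in> frames. frame_winding (t A) (t B) (t C) p \<noteq> 0}"
  define S where "S = ?s M N P \<union> ?s L N P \<union> ?s L M P \<union> ?s L M N"
  have S: "finite S" "S \<subseteq> frames"
    using SL assms(1-4) by (auto simp: S_def intro!: finite_frame_winding)
  have eq: "crossing (t M) (t N) (t P) = sum (frame_winding (t M) (t N) (t P)) S"
    "crossing (t L) (t N) (t P) = sum (frame_winding (t L) (t N) (t P)) S"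
    "crossing (t L) (t M) (t P) = sum (frame_winding (t L) (t M) (t P)) S"
    "crossing (t L) (t M) (t N) = sum (frame_winding (t L) (t M) (t N)) S"
    by (rule crossing_eq_sum[OF S(1) _ S(2)]; force simp: S_def)+
  have "frame_winding (t M) (t N) (t P) p - frame_winding (t L) (t N) (t P) p
      + frame_winding (t L) (t M) (t P) p - frame_winding (t L) (t M) (t N) p = 0" if "p \<in> S" for p
  proof -
    obtain v w where p: "p = (v, w)" by (cases p)
    with that S(2) have f: "(v, w) \<in> frames" by auto
    \<comment> \<open>Repeating \<open>P\<close> beyond index 3 makes every \<open>x i\<close>
      nondegenerate, as \<open>winding_cocycle\<close> demands.\<close>
    define x where "x i = gram (t (if i = 0 then L else if i = 1 then M else if i = 2 then N else P)) v"
      for i :: nat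
    have "cross3 w (x i) \<noteq> (0, 0, 0)" for i
      using assms(1-4) f by (auto simp: x_def t_def dest: frames_nondegenerate)
    from winding_cocycle[of w x, OF this] show ?thesis
      by (simp add: p frame_winding_def x_def)
  qed
  then have "(\<Sum>p\<in>S. frame_winding (t M) (t N) (t P) p - frame_winding (t L) (t N) (t P) p
      + frame_winding (t L) (t M) (t P) p - frame_winding (t L) (t M) (t N) p) = 0"
    by (rule sum.neutral[OF ballI])
  then show ?thesis by (simp add: eq sum.distrib sum_subtractf)
qed

text \<open>\<open>crossing\<close> is invariant under multiplication on the right, so the homogeneous vertices
  \<open>gh, h, 1\<close> replace the usual \<open>1, g, gh\<close>, avoiding inverses.\<close>

definition crossing_class :: "int mat \<Rightarrow> int mat \<Rightarrow> int" where
  "crossing_class g h = crossing (unip 1 2 * (g * h)) (unip 1 2 * h) (unip 1 2)"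

text \<open>The tetrahedron has vertices \<open>ghk\<close>, \<open>hk\<close>, \<open>k\<close>,
  \<open>1\<close>. Its face without the vertex \<open>1\<close> is the triangle of
  \<open>crossing_class g h\<close> translated by \<open>k\<close>.\<close>

lemma crossing_class_cocycle:
  assumes "g \<in> congruence3" "h \<in> congruence3" "k \<in> congruence3"
  shows "crossing_class h k - crossing_class (g * h) k + crossing_class g (h * k)
    - crossing_class g h = 0"
proof -
  note [simp] = congruence3_carrier[OF assms(1)] congruence3_carrier[OF assms(2)]
    congruence3_carrier[OF assms(3)]
  have [simp]: "unip 1 2 * 1\<^sub>m 3 = (unip 1 2 :: int mat)"
    using right_mult_one_mat[OF unip_carrier] .
  have assoc [simp]: "g * h * k = g * (h * k)" by (rule assoc_mult_mat[of _ 3 3 _ 3 _ 3]) simp_all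
  have "crossing (unip 1 2 * (g * h) * k) (unip 1 2 * h * k) (unip 1 2 * k)
      = crossing_class g h"
    unfolding crossing_class_def by (rule crossing_act[OF assms(3)]) (auto intro!: mult_carrier_mat[of _ 3 3])
  moreover have "unip 1 2 * (g * h) * k = unip 1 2 * (g * (h * k))"
    by (subst assoc_mult_mat[of _ 3 3 _ 3 _ 3]) (auto intro!: mult_carrier_mat[of _ 3 3])
  moreover have "unip 1 2 * h * k = unip 1 2 * (h * k)"
    by (rule assoc_mult_mat[of _ 3 3 _ 3 _ 3]) auto
  ultimately have "crossing_class g h
      = crossing (unip 1 2 * (g * (h * k))) (unip 1 2 * (h * k)) (unip 1 2 * k)"
    by simp
  then show ?thesis
    using crossing_cocycle[of "g * (h * k)" "h * k" k "1\<^sub>m 3"] assms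
    by (simp add: crossing_class_def congruence3_mult congruence3_one)
qed

text \<open>The alternating sum of the cocycle identities for \<open>(g, h, k)\<close>,
  \<open>(h, g, k)\<close> and \<open>(h, k, g)\<close>.\<close>

lemma crossing_class_commutator_mult:
  assumes "g \<in> congruence3" "h \<in> congruence3" "k \<in> congruence3"
    and "g * h = h * g" "g * k = k * g"
  shows "crossing_class g (h * k) - crossing_class (h * k) g
    = (crossing_class g h - crossing_class h g) + (crossing_class g k - crossing_class k g)"
  using crossing_class_cocycle[OF assms(1-3)] crossing_class_cocycle[OF assms(2,1,3)]
    crossing_class_cocycle[OF assms(2,3,1)] assms(4,5)
  by simp

section \<open>Crossings of the unipotent torus\<close>

lemma frame_winding_unip_neq_0D:
  assumes "(v, w) \<in> frames"
    and "frame_winding (unip a b) (unip c d) (unip e f) (v, w) \<noteq> 0"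
  shows "\<exists>i j. v = (i, j, 1) \<and> w = (0, 0, 1) \<and> 3 dvd i \<and> 3 dvd j"
proof -
  obtain p q r l where "p \<ge> 0" "q \<ge> 0" "r \<ge> 0" "p + q + r > 0"
    "\<And>z. p * dot3 (gram (unip a b) v) z + q * dot3 (gram (unip c d) v) z
      + r * dot3 (gram (unip e f) v) z = l * dot3 w z"
    using frame_winding_neq_0D[OF assms(2)] by metis
  then show ?thesis
    using assms(1) unip_hull_orthogonal[of p q r
        "\<lambda>i. if i = 0 then a else if i = 1 then c else e"
        "\<lambda>i. if i = 0 then b else if i = 1 then d else f" v l w]
    by simp
qed

text \<open>Modulo \<open>(0, 0, 1)\<close> the triangle is that of \<open>(a, b)\<close>,
  \<open>(c, d)\<close>, \<open>(e, f)\<close> shifted by \<open>(i, j)\<close>, so the frame tests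
  the position of the point \<open>(- i, - j)\<close> of the lattice of multiples of 3.\<close>

lemma frame_winding_unip:
  "frame_winding (unip a b) (unip c d) (unip e f) ((i, j, 1), (0, 0, 1)) =
    winding ((i + a) * (j + d) - (j + b) * (i + c)) ((i + c) * (j + f) - (j + d) * (i + e))
      ((i + e) * (j + b) - (j + f) * (i + a))"
  by (simp add: frame_winding_def gram_unip triple_def algebra_simps)

text \<open>The square with corners \<open>(1, 2)\<close> and \<open>(4, 5)\<close> contains just
  one point with both coordinates divisible by 3, namely \<open>(3, 3)\<close>, and it lies on the
  other side of the diagonal. The diagonal itself would need \<open>i - j = 1\<close>, impossible
  for multiples of 3.\<close>

lemma crossing_unip_upper: "crossing (unip 4 5) (unip 1 5) (unip 1 2) = 0"
proof -
  have False if f: "(v, w) \<in> frames"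
    and nz: "frame_winding (unip 4 5) (unip 1 5) (unip 1 2) (v, w) \<noteq> 0" for v w
  proof -
    obtain i j where ij: "v = (i, j, 1)" "w = (0, 0, 1)" "3 dvd i" "3 dvd j"
      using frame_winding_unip_neq_0D[OF f nz] by blast
    have "(i + 4) * (j + 5) - (j + 5) * (i + 1) = 3 * j + 15"
      "(i + 1) * (j + 2) - (j + 5) * (i + 1) = - 3 * i - 3"
      "(i + 1) * (j + 5) - (j + 2) * (i + 4) = 3 * i - 3 * j - 3"
      by (simp_all add: algebra_simps)
    then have "winding (3 * j + 15) (- 3 * i - 3) (3 * i - 3 * j - 3) \<noteq> 0"
      using nz by (simp only: ij frame_winding_unip not_False_eq_True)
    from winding_neq_0D[OF this] ij(3,4) show False by presburger
  qed
  then have "frame_winding (unip 4 5) (unip 1 5) (unip 1 2) p = 0" if "p \<in> frames" for p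
    using that by (cases p) blast
  then have "{p. p \<in> frames \<and> frame_winding (unip 4 5) (unip 1 5) (unip 1 2) p \<noteq> 0} = {}" by blast
  then show ?thesis by (simp only: crossing_def sum.empty)
qed

text \<open>This triangle contains \<open>(3, 3)\<close> in its interior and is traversed clockwise,
  so the winding number is \<open>- 1\<close>, counted four times.\<close>

lemma crossing_unip_lower: "crossing (unip 4 5) (unip 4 2) (unip 1 2) = - 4"
proof -
  have "{p. p \<in> frames \<and> frame_winding (unip 4 5) (unip 4 2) (unip 1 2) p \<noteq> 0}
      = {((- 3, - 3, 1), (0, 0, 1))}"
  proof (rule Set.set_eqI, rule iffI)
    fix p assume "p \<in> {p. p \<in> frames \<and> frame_winding (unip 4 5) (unip 4 2) (unip 1 2) p \<noteq> 0}"
    then obtain v w where p: "p = (v, w)" and f: "(v, w) \<in> frames"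
      and nz: "frame_winding (unip 4 5) (unip 4 2) (unip 1 2) (v, w) \<noteq> 0"
      by (cases p) auto
    obtain i j where ij: "v = (i, j, 1)" "w = (0, 0, 1)" "3 dvd i" "3 dvd j"
      using frame_winding_unip_neq_0D[OF f nz] by blast
    have "(i + 4) * (j + 2) - (j + 5) * (i + 4) = - 3 * i - 12"
      "(i + 4) * (j + 2) - (j + 2) * (i + 1) = 3 * j + 6"
      "(i + 1) * (j + 5) - (j + 2) * (i + 4) = 3 * i - 3 * j - 3"
      by (simp_all add: algebra_simps)
    then have "winding (- 3 * i - 12) (3 * j + 6) (3 * i - 3 * j - 3) \<noteq> 0"
      using nz by (simp only: ij frame_winding_unip not_False_eq_True)
    from winding_neq_0D[OF this] ij(3,4) have "i = - 3 \<and> j = - 3" by presburger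
    then show "p \<in> {((- 3, - 3, 1), (0, 0, 1))}" by (simp add: p ij)
  next
    fix p :: "vec3 \<times> vec3" assume "p \<in> {((- 3, - 3, 1), (0, 0, 1))}"
    then show "p \<in> {p. p \<in> frames \<and> frame_winding (unip 4 5) (unip 4 2) (unip 1 2) p \<noteq> 0}"
      by (simp add: frame_winding_unip winding_def frames_def e3_mod3_def)
  qed
  then show ?thesis
    unfolding crossing_def by (simp add: frame_winding_unip winding_def)
qed

text \<open>The value for \<open>n = 1\<close> is the difference of the two triangles forming the
  square; additivity in the second element gives the rest.\<close>

lemma crossing_class_commutator_unip:
  "crossing_class (unip 3 0) (unip 0 (3 * int n)) - crossing_class (unip 0 (3 * int n)) (unip 3 0)
    = 4 * int n"
proof (induction n)
  case 0
  have "unip 3 0 \<in> congruence3" "unip 0 0 \<in> congruence3" by (simp_all add: unip_congruence3)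
  \<comment> \<open>\<open>unip 0 0\<close> is idempotent, so its value equals its own
    double.\<close>
  from crossing_class_commutator_mult[OF this(1) this(2) this(2)]
  show ?case by (simp add: unip_mult)
next
  case (Suc n)
  have "crossing_class (unip 3 0) (unip 0 3) - crossing_class (unip 0 3) (unip 3 0) = 4"
    by (simp add: crossing_class_def unip_mult crossing_unip_upper crossing_unip_lower)
  moreover have "unip 0 (3 * int (Suc n)) = unip 0 (3 * int n) * unip 0 3"
    by (simp add: unip_mult algebra_simps)
  ultimately show ?case
    using Suc crossing_class_commutator_mult[of "unip 3 0" "unip 0 (3 * int n)" "unip 0 3"]
    by (simp add: unip_congruence3 unip_mult)
qed

section \<open>Detecting infinite dimension by linear functionals\<close>

text \<open>By linearity the powers may be replaced by any polynomial; take one that vanishes at all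
  nodes except \<open>x i\<close>.\<close>

lemma vandermonde_zero:
  fixes x :: "'i \<Rightarrow> 'k::field"
  assumes "finite N" "inj_on x N" "i \<in> N"
    and "\<And>m. (\<Sum>j\<in>N. a j * x j ^ m) = 0"
  shows "a i = 0"
proof -
  have poly: "(\<Sum>j\<in>N. a j * poly p (x j)) = 0" for p
  proof -
    have "(\<Sum>j\<in>N. a j * poly p (x j)) = (\<Sum>j\<in>N. \<Sum>m\<le>degree p. coeff p m * (a j * x j ^ m))"
      by (simp add: poly_altdef sum_distrib_left mult_ac)
    also have "\<dots> = (\<Sum>m\<le>degree p. coeff p m * (\<Sum>j\<in>N. a j * x j ^ m))"
      by (subst sum.swap) (simp add: sum_distrib_left)
    finally show ?thesis by (simp add: assms(4))
  qed
  define p where "p = (\<Prod>j\<in>N - {i}. [:- x j, 1:])"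
  have "poly p (x j) = 0" if "j \<in> N - {i}" for j
    using that assms(1) by (auto simp: p_def poly_prod prod_zero_iff)
  then have "(\<Sum>j\<in>N. a j * poly p (x j)) = a i * poly p (x i)"
    using assms(1,3) by (subst sum.remove[of _ i]) auto
  moreover have "poly p (x i) \<noteq> 0"
    using assms(1-3) by (auto simp: p_def poly_prod prod_zero_iff inj_on_def)
  ultimately show ?thesis using poly[of p] by simp
qed

text \<open>The functionals turn a finite linear relation among the \<open>e n\<close> into
  vanishing power sums in the distinct nodes \<open>x n\<close>, so \<open>vandermonde_zero\<close>
  kills its coefficients.\<close>

lemma not_fin_dimI:
  fixes V :: "('k::field, 'v) module" and \<phi> :: "nat \<Rightarrow> 'v \<Rightarrow> 'k" and x :: "nat \<Rightarrow> 'k"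
  assumes V: "vectorspace class_ring V"
    and add: "\<And>m u v. u \<in> carrier V \<Longrightarrow> v \<in> carrier V \<Longrightarrow> \<phi> m (u \<oplus>\<^bsub>V\<^esub> v) = \<phi> m u + \<phi> m v"
    and smult: "\<And>m c u. u \<in> carrier V \<Longrightarrow> \<phi> m (c \<odot>\<^bsub>V\<^esub> u) = c * \<phi> m u"
    and e: "\<And>n. e n \<in> carrier V" "\<And>m n. \<phi> m (e n) = s * x n ^ m"
    and "s \<noteq> 0" "inj x"
  shows "\<not> vectorspace.fin_dim class_ring V"
proof
  interpret V: vectorspace class_ring V by fact
  have zero: "\<phi> m \<zero>\<^bsub>V\<^esub> = 0" for m
    using add[of "\<zero>\<^bsub>V\<^esub>" "\<zero>\<^bsub>V\<^esub>" m]
    by (simp only: V.l_zero V.zero_closed add_cancel_right_right simp_thms)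
  have lincomb: "\<phi> m (V.lincomb a A) = (\<Sum>v\<in>A. a v * \<phi> m v)"
    if "finite A" "A \<subseteq> carrier V" for a A m
    using that
  proof (induction A rule: finite_induct)
    case empty
    then show ?case by (simp add: V.lincomb_def zero)
  next
    case (insert v A)
    have "V.lincomb a (A \<union> {v}) = a v \<odot>\<^bsub>V\<^esub> v \<oplus>\<^bsub>V\<^esub> V.lincomb a A"
      using insert by (intro V.lincomb_insert) auto
    then show ?case
      using insert by (simp add: add smult V.lincomb_closed)
  qed
  have inj: "inj e"
    using e(2)[of 1] \<open>s \<noteq> 0\<close> \<open>inj x\<close> by (intro injI) (metis injD mult_left_cancel power_one_right)
  have "V.lin_indpt (range e)"
  proof
    assume "V.lin_dep (range e)"
    then obtain A a v where A: "finite A" "A \<subseteq> range e" "V.lincomb a A = \<zero>\<^bsub>V\<^esub>" "v \<in> A" "a v \<noteq> 0"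
      unfolding V.lin_dep_def by auto
    obtain N where N: "A = e ` N" "finite N"
      using finite_subset_image[OF A(1,2)] by blast
    obtain i where i: "i \<in> N" "v = e i" using A(4) N by blast
    have injN: "inj_on e N" using inj by (rule inj_on_subset) simp
    have "(\<Sum>j\<in>N. a (e j) * x j ^ m) = 0" for m
    proof -
      have "0 = \<phi> m (V.lincomb a A)" by (simp add: A(3) zero)
      also have "\<dots> = (\<Sum>v\<in>A. a v * \<phi> m v)" using A(1,2) e(1) by (intro lincomb) auto
      also have "\<dots> = (\<Sum>j\<in>N. a (e j) * \<phi> m (e j))" by (simp add: N sum.reindex[OF injN])
      also have "\<dots> = s * (\<Sum>j\<in>N. a (e j) * x j ^ m)" by (simp add: e(2) sum_distrib_left mult_ac)
      finally show ?thesis using \<open>s \<noteq> 0\<close> by simp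
    qed
    from vandermonde_zero[OF N(2) _ i(1), of x "a \<circ> e"] this \<open>inj x\<close> i(2) A(5)
    show False by (auto simp: inj_on_subset)
  qed
  moreover assume V.fin_dim
  ultimately have "finite (range e)"
    using e(1) by (intro V.fin_dim_li_fin) auto
  then show False using inj by (simp add: finite_image_iff)
qed

section \<open>Second cohomology\<close>

lemma tuples_2: "xs \<in> tuples G 2 \<longleftrightarrow> (\<exists>g\<in>carrier G. \<exists>h\<in>carrier G. xs = [g, h])"
  by (auto simp: tuples_def length_Suc_conv numeral_2_eq_2)

lemma tuples_3:
  "xs \<in> tuples G (Suc 2) \<longleftrightarrow> (\<exists>g\<in>carrier G. \<exists>h\<in>carrier G. \<exists>k\<in>carrier G. xs = [g, h, k])"
  by (auto simp: tuples_def length_Suc_conv numeral_2_eq_2)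

lemma cocycles_2I:
  fixes c :: "'g \<Rightarrow> 'g \<Rightarrow> 'k::field"
  assumes "monoid G"
    and "\<And>g h k. g \<in> carrier G \<Longrightarrow> h \<in> carrier G \<Longrightarrow> k \<in> carrier G \<Longrightarrow>
      c h k - c (g \<otimes>\<^bsub>G\<^esub> h) k + c g (h \<otimes>\<^bsub>G\<^esub> k) - c g h = 0"
  shows "restrict (\<lambda>xs. c (xs ! 0) (xs ! 1)) (tuples G 2) \<in> cocycles G 2"
proof -
  interpret monoid G by fact
  have 2: "[g, h] \<in> tuples G 2" if "g \<in> carrier G" "h \<in> carrier G" for g h
    using that by (simp add: tuples_2)
  have "coboundary G 2 (restrict (\<lambda>xs. c (xs ! 0) (xs ! 1)) (tuples G 2)) xs = 0"
    if xs3: "xs \<in> tuples G (Suc 2)" for xs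
  proof -
    obtain g h k where xs: "g \<in> carrier G" "h \<in> carrier G" "k \<in> carrier G" "xs = [g, h, k]"
      using tuples_3[THEN iffD1, OF xs3] by blast
    show ?thesis
      using xs3 assms(2)[OF xs(1-3)] xs
      by (simp add: coboundary_def bar_face_def eval_nat_numeral 2[unfolded numeral_2_eq_2])
  qed
  moreover have "coboundary G 2 f xs = undefined" if "xs \<notin> tuples G (Suc 2)"
    for f :: "'g list \<Rightarrow> 'k" and xs
    unfolding coboundary_def using that by (rule restrict_apply[THEN trans, OF if_not_P])
  ultimately show ?thesis
    by (simp add: cocycles_def cochains_simps fun_eq_iff)
qed

text \<open>The coboundary of \<open>f\<close> at \<open>[g, h]\<close> is
  \<open>f [h] - f [gh] + f [g]\<close>, which is symmetric in commuting elements.\<close>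

lemma coboundary_commutator:
  fixes f :: "'g list \<Rightarrow> 'k::field"
  assumes "monoid G" "g \<in> carrier G" "h \<in> carrier G" "g \<otimes>\<^bsub>G\<^esub> h = h \<otimes>\<^bsub>G\<^esub> g"
    and "b \<in> coboundaries G 2"
  shows "b [g, h] = (b [h, g] :: 'k)"
proof -
  obtain f where b: "b = coboundary G 1 f"
    using assms(5) by (auto simp: coboundaries_def numeral_2_eq_2)
  have "[g, h] \<in> tuples G (Suc 1)" "[h, g] \<in> tuples G (Suc 1)"
    using assms(2,3) by (simp_all add: tuples_def)
  then show ?thesis
    using assms(4) by (simp add: b coboundary_def bar_face_def eval_nat_numeral)
qed

definition cocycle_class ::
  "('g, 'm) monoid_scheme \<Rightarrow> nat \<Rightarrow> ('g list \<Rightarrow> 'k::field) \<Rightarrow> ('g list \<Rightarrow> 'k) set" where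
  "cocycle_class G n f = coboundaries G n +>\<^bsub>(cochains G n)\<lparr>carrier := cocycles G n\<rparr>\<^esub> f"

lemma cocycle_class_eq:
  "cocycle_class G n f = (\<lambda>b. restrict (\<lambda>x. b x + f x) (tuples G n)) ` coboundaries G n"
  by (auto simp: cocycle_class_def a_r_coset_def' cochains_simps)

lemma carrier_cohomology: "carrier (cohomology G n) = cocycle_class G n ` cocycles G n"
  by (auto simp: cohomology_def quot_module_def A_RCOSETS_def' cocycle_class_def)

lemma cocycle_class_self:
  fixes f :: "'g list \<Rightarrow> 'k::field"
  assumes "monoid G" "f \<in> cocycles G n"
  shows "f \<in> cocycle_class G n f"
proof -
  have zero: "restrict (\<lambda>_. 0) (tuples G n) \<in> (coboundaries G n :: ('g list \<Rightarrow> 'k) set)"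
  proof (cases n)
    case (Suc m)
    have "coboundary G m (restrict (\<lambda>_. 0) (tuples G m)) = restrict (\<lambda>_. 0 :: 'k) (tuples G n)"
      using mod_hom.f0_is_0[OF coboundary_hom[OF assms(1), of m]] by (simp add: cochains_simps Suc)
    moreover have "restrict (\<lambda>_. 0) (tuples G m) \<in> carrier (cochains G m :: ('k, _) module)"
      by (simp add: cochains_simps)
    ultimately show ?thesis
      by (simp add: coboundaries_def Suc rev_image_eqI del: restrict_apply)
  qed (simp add: coboundaries_def cochains_simps)
  have "f \<in> tuples G n \<rightarrow>\<^sub>E UNIV" using assms(2) by (simp add: cocycles_def cochains_simps)
  then have "f = restrict (\<lambda>x. restrict (\<lambda>_. 0) (tuples G n) x + f x) (tuples G n)"
    by (auto simp: fun_eq_iff PiE_def extensional_def)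
  then show ?thesis unfolding cocycle_class_eq by (intro rev_image_eqI[OF zero])
qed

text \<open>Evaluation of a class on the cycle \<open>[g | h] - [h | g]\<close> of commuting elements, which does not
  depend on the representative.\<close>

definition torus_value :: "'g \<Rightarrow> 'g \<Rightarrow> ('g list \<Rightarrow> 'k::field) set \<Rightarrow> 'k" where
  "torus_value g h X = (let f = SOME f. f \<in> X in f [g, h] - f [h, g])"

text \<open>Representatives of a class differ by coboundaries, on which the value vanishes by
  \<open>coboundary_commutator\<close>. Hence any convenient representative may replace the chosen
  one.\<close>

lemma torus_value_linear:
  fixes G :: "('g, 'm) monoid_scheme" and g h :: 'g
  assumes "monoid G" "g \<in> carrier G" "h \<in> carrier G" "g \<otimes>\<^bsub>G\<^esub> h = h \<otimes>\<^bsub>G\<^esub> g"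
  defines "\<phi> \<equiv> torus_value g h :: ('g list \<Rightarrow> 'k::field) set \<Rightarrow> 'k"
  shows "\<And>X Y. X \<in> carrier (cohomology G 2) \<Longrightarrow> Y \<in> carrier (cohomology G 2) \<Longrightarrow>
      \<phi> (X \<oplus>\<^bsub>cohomology G 2\<^esub> Y) = \<phi> X + \<phi> Y"
    and "\<And>c X. X \<in> carrier (cohomology G 2) \<Longrightarrow> \<phi> (c \<odot>\<^bsub>cohomology G 2\<^esub> X) = c * \<phi> X"
    and "\<And>f. f \<in> cocycles G 2 \<Longrightarrow> \<phi> (cocycle_class G 2 f) = f [g, h] - f [h, g]"
proof -
  let ?H = "cohomology G 2 :: ('k, _) module"
  define \<psi> :: "('g list \<Rightarrow> 'k) \<Rightarrow> 'k" where "\<psi> f = f [g, h] - f [h, g]" for f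
  have \<phi>: "\<phi> X = \<psi> (SOME f. f \<in> X)" for X
    by (simp add: \<phi>_def torus_value_def \<psi>_def Let_def)
  have t: "[g, h] \<in> tuples G 2" "[h, g] \<in> tuples G 2" using assms(2,3) by (auto simp: tuples_2)
  have const: "\<psi> y = \<psi> f" if y: "y \<in> cocycle_class G 2 f" for y f
  proof -
    obtain b where "b \<in> coboundaries G 2" "y = restrict (\<lambda>x. b x + f x) (tuples G 2)"
      using y by (auto simp: cocycle_class_eq)
    then show ?thesis
      using t coboundary_commutator[OF assms(1-4), of b] by (simp add: \<psi>_def)
  qed
  have class_val: "\<phi> (cocycle_class G 2 f) = \<psi> f" if "f \<in> cocycles G 2" for f
    unfolding \<phi> using cocycle_class_self[OF assms(1) that] const by (metis someI_ex)
  have val: "\<phi> X = \<psi> f" if "X \<in> carrier ?H" "f \<in> X" for X f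
    using that class_val const by (auto simp: carrier_cohomology)
  interpret H: vectorspace class_ring ?H by (rule cohomology_vectorspace[OF assms(1)])
  show "\<phi> (X \<oplus>\<^bsub>?H\<^esub> Y) = \<phi> X + \<phi> Y" if X: "X \<in> carrier ?H" and Y: "Y \<in> carrier ?H" for X Y
  proof -
    obtain f k where fk: "f \<in> X" "k \<in> Y"
      using X Y cocycle_class_self[OF assms(1)] by (auto simp: carrier_cohomology)
    then have "restrict (\<lambda>x. f x + k x) (tuples G 2) \<in> X \<oplus>\<^bsub>?H\<^esub> Y"
      by (auto simp: cohomology_def quot_module_def set_add_def' cochains_simps)
    then show ?thesis
      using val[OF X fk(1)] val[OF Y fk(2)] val[OF H.a_closed[OF X Y]] t by (simp add: \<psi>_def)
  qed
  show "\<phi> (c \<odot>\<^bsub>?H\<^esub> X) = c * \<phi> X" if X: "X \<in> carrier ?H" for c X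
  proof -
    obtain f where f: "f \<in> cocycles G 2" "X = cocycle_class G 2 f"
      using X by (auto simp: carrier_cohomology)
    have cX: "c \<odot>\<^bsub>?H\<^esub> X \<in> carrier ?H" using X by (intro H.smult_closed) simp_all
    have "c \<odot>\<^bsub>?H\<^esub> X = (\<Union>y\<in>X. cocycle_class G 2 (restrict (\<lambda>x. c * y x) (tuples G 2)))"
      by (simp add: cohomology_def quot_module_def cocycle_class_def cochains_simps)
    \<comment> \<open>Classes are nonempty; an element \<open>z\<close> of the multiple leads to a
      representative \<open>y\<close> of \<open>X\<close> whose multiple represents the same
      class.\<close>
    moreover obtain z where "z \<in> c \<odot>\<^bsub>?H\<^esub> X"
      using cX cocycle_class_self[OF assms(1)] by (auto simp: carrier_cohomology)
    ultimately obtain y where y: "y \<in> X" "z \<in> cocycle_class G 2 (restrict (\<lambda>x. c * y x) (tuples G 2))"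
      by blast
    have "\<phi> (c \<odot>\<^bsub>?H\<^esub> X) = \<psi> z" by (rule val[OF cX \<open>z \<in> c \<odot>\<^bsub>?H\<^esub> X\<close>])
    also have "\<dots> = c * \<psi> y" using const[OF y(2)] t by (simp add: \<psi>_def right_diff_distrib)
    finally show ?thesis using val[OF X y(1)] by simp
  qed
  show "\<phi> (cocycle_class G 2 f) = f [g, h] - f [h, g]" if "f \<in> cocycles G 2" for f
    using class_val[OF that] by (simp add: \<psi>_def)
qed

section \<open>Evaluation at multiples of three\<close>

definition eval_mat :: "int \<Rightarrow> int poly mat \<Rightarrow> int mat" where
  "eval_mat c = map_mat (\<lambda>p. poly p c)"

lemma Gamma_iff:
  "A \<in> carrier Gamma \<longleftrightarrow> A \<in> carrier_mat 3 3 \<and> det A = 1 \<and> map_mat iota A = 1\<^sub>m 3"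
  by (simp add: Gamma_def kernel_def SL_def iota_hat_def conj_assoc)

lemma mult_Gamma: "A \<otimes>\<^bsub>Gamma\<^esub> B = A * B"
  by (simp add: Gamma_def SL_def)

lemma comm_ring_hom_eval: "comm_ring_hom (\<lambda>p. poly p (c :: int))"
  by unfold_locales simp_all

lemma eval_mat_mult:
  assumes "A \<in> carrier Gamma" "B \<in> carrier Gamma"
  shows "eval_mat c (A * B) = eval_mat c A * eval_mat c B"
proof -
  interpret e: comm_ring_hom "\<lambda>p. poly p c" by (rule comm_ring_hom_eval)
  show ?thesis
    using assms unfolding eval_mat_def Gamma_iff by (intro e.mat_hom_mult) auto
qed

text \<open>A polynomial is its constant term plus a multiple of the variable, so modulo 3
  evaluation at a multiple of 3 agrees with \<open>iota\<close>.\<close>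

lemma eval_mat_congruence3:
  assumes "3 dvd c" "A \<in> carrier Gamma"
  shows "eval_mat c A \<in> congruence3"
proof -
  interpret e: comm_ring_hom "\<lambda>p. poly p c" by (rule comm_ring_hom_eval)
  have "(of_int c :: 3) = 0" using assms(1) by (simp add: of_int3_eq_0)
  then have iota: "of_int (poly p c) = iota p" for p
    by (cases p) (simp add: iota_def)
  have "map_mat of_int (eval_mat c A) = map_mat iota A"
    by (rule eq_matI) (simp_all add: eval_mat_def iota)
  then show ?thesis
    using assms(2) by (simp add: Gamma_iff congruence3_def kernel_def SL_def eval_mat_def e.hom_det)
qed

lemma eval_mat_unip: "eval_mat c (unip p q) = unip (poly p c) (poly q c)"
  by (rule eq_matI) (auto simp: eval_mat_def unip_def)

lemma unip_Gamma:
  assumes "iota p = 0" "iota q = 0"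
  shows "unip p q \<in> carrier Gamma"
proof -
  have "map_mat iota (unip p q) = 1\<^sub>m 3"
    using assms by (intro eq_matI) (auto simp: unip_def)
  then show ?thesis by (simp add: Gamma_iff)
qed

definition crossing_cochain :: "nat \<Rightarrow> int poly mat list \<Rightarrow> rat" where
  "crossing_cochain n = restrict (\<lambda>xs. of_int (crossing_class (eval_mat (3 * int n) (xs ! 0))
    (eval_mat (3 * int n) (xs ! 1)))) (tuples Gamma 2)"

lemma crossing_cochain_cocycle: "crossing_cochain n \<in> cocycles Gamma 2"
  unfolding crossing_cochain_def
proof (rule cocycles_2I)
  fix g h k assume "g \<in> carrier Gamma" "h \<in> carrier Gamma" "k \<in> carrier Gamma"
  then show "rat_of_int (crossing_class (eval_mat (3 * int n) h) (eval_mat (3 * int n) k))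
      - rat_of_int (crossing_class (eval_mat (3 * int n) (g \<otimes>\<^bsub>Gamma\<^esub> h)) (eval_mat (3 * int n) k))
      + rat_of_int (crossing_class (eval_mat (3 * int n) g) (eval_mat (3 * int n) (h \<otimes>\<^bsub>Gamma\<^esub> k)))
      - rat_of_int (crossing_class (eval_mat (3 * int n) g) (eval_mat (3 * int n) h)) = 0"
    using arg_cong[OF crossing_class_cocycle[of "eval_mat (3 * int n) g" "eval_mat (3 * int n) h"
          "eval_mat (3 * int n) k"], of rat_of_int]
    by (simp add: mult_Gamma eval_mat_mult eval_mat_congruence3)
qed (use group_Gamma group.is_monoid in blast)

theorem theorem1:
  shows "vectorspace class_ring (cohomology Gamma 2 :: (rat, _) module) \<and>
    \<not> vectorspace.fin_dim class_ring (cohomology Gamma 2 :: (rat, _) module)"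
proof
  have monoid: "monoid Gamma" using group_Gamma by (rule group.is_monoid)
  let ?H = "cohomology Gamma 2 :: (rat, _) module"
  show V: "vectorspace class_ring ?H" using monoid by (rule cohomology_vectorspace)
  define a :: "int poly mat" where "a = unip [:3:] 0"
  define b :: "nat \<Rightarrow> int poly mat" where "b m = unip 0 (monom 3 m)" for m
  have ab: "a \<in> carrier Gamma" "b m \<in> carrier Gamma" "a \<otimes>\<^bsub>Gamma\<^esub> b m = b m \<otimes>\<^bsub>Gamma\<^esub> a" for m
  proof -
    have "iota [:3:] = 0" "iota (monom 3 m) = 0"
      unfolding iota_def of_int3_eq_0 by (simp_all add: poly_monom)
    then show "a \<in> carrier Gamma" "b m \<in> carrier Gamma"
      by (simp_all add: a_def b_def unip_Gamma)
    show "a \<otimes>\<^bsub>Gamma\<^esub> b m = b m \<otimes>\<^bsub>Gamma\<^esub> a"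
      by (simp add: a_def b_def mult_Gamma unip_mult)
  qed
  note torus = torus_value_linear[OF monoid ab(1) ab(2) ab(3)]
  show "\<not> vectorspace.fin_dim class_ring ?H"
  \<comment> \<open>Here \<open>s = 4\<close>, the nodes are \<open>3 * n\<close>, the vectors are
    the pullbacks along \<open>t = 3n\<close>, and functional \<open>m\<close> evaluates on the
    torus of \<open>a\<close> and \<open>b m\<close>.\<close>
  proof (rule not_fin_dimI[OF V torus(1,2)])
    show "cocycle_class Gamma 2 (crossing_cochain n) \<in> carrier ?H" for n
      by (simp add: carrier_cohomology crossing_cochain_cocycle)
    show "torus_value a (b m) (cocycle_class Gamma 2 (crossing_cochain n))
        = 4 * (3 * rat_of_nat n) ^ m" for m n
    proof -
      have "[a, b m] \<in> tuples Gamma 2" "[b m, a] \<in> tuples Gamma 2"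
        using ab by (auto simp: tuples_2)
      \<comment> \<open>The exponent \<open>m\<close> enters here: \<open>3 * t^m\<close> evaluates
        to three times \<open>(3 * n)^m\<close>, the factor in which the commutator value is
        linear.\<close>
      moreover have "eval_mat (3 * int n) a = unip 3 0"
        "eval_mat (3 * int n) (b m) = unip 0 (3 * int ((3 * n) ^ m))"
        by (simp_all add: a_def b_def eval_mat_unip poly_monom)
      ultimately show ?thesis
        unfolding torus(3)[OF crossing_cochain_cocycle]
        using arg_cong[OF crossing_class_commutator_unip[of "(3 * n) ^ m"], of rat_of_int]
        by (simp add: crossing_cochain_def)
    qed
    show "inj (\<lambda>n. 3 * rat_of_nat n)" by (auto intro: injI)
  qed simp_all
qed

end
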